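(* Let $n\ge 0$ and let $Q_n$ be the free quandle on generators $y_1,\dots,y_n$. 1. Let $\pi=(\pi_h:\mathrm{cod}(h)\to\mathrm{cod}(h))_{\mathrm{dom}(h)=Q_n}$ be a (not necessarily natural) family of quandle endomorphisms, indexed by the quandle morphisms $h$ with domain $Q_n$. Then $\pi\in\mathcal{Z}_{\mathrm{Quandle}}(Q_n)$ if and only if there is a unique reduced group word $y_{i_1}^{\epsilon_1}\cdots y_{i_m}^{\epsilon_m}$ over $y_1,\dots,y_n$ with the property that for every quandle morphism $h:Q_n\to Q$ and every $q\in Q$, $$\pi_h(q)=q\lhd^{\epsilon_1}h_{i_1}\lhd^{\epsilon_2}\cdots\lhd^{\epsilon_m}h_{i_m}\in Q,$$ where $h_i:=h(y_i)$ for $1\le i\le n$. 2. Let $h:Q_n\to Q_n$ be a quandle endomorphism. Then $h$ is a categorical inner automorphism if and only if there is a unique reduced group word $y_{i_1}^{\epsilon_1}\cdots y_{i_m}^{\epsilon_m}$ over $y_1,\dots,y_n$ such that $h(a)=a\lhd^{\epsilon_1}y_{i_1}\lhd^{\epsilon_2}\cdots\lhd^{\epsilon_m}y_{i_m}$ for all $a\in Q_n$. 3. Let $h:Q_n\to Q_n$ be a quandle endomorphism. Then $h$ is a categorical inner automorphism if and only if $h$ is an algebraic inner automorphism.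
   Context: A quandle is a set with two binary operations $\lhd,\lhd^{-1}$ satisfying, for all $x,y,z$: $(x\lhd y)\lhd z=(x\lhd z)\lhd(y\lhd z)$; $(x\lhd^{-1}y)\lhd^{-1}z=(x\lhd^{-1}z)\lhd^{-1}(y\lhd^{-1}z)$; $(x\lhd y)\lhd^{-1}y=x$; $(x\lhd^{-1}y)\lhd y=x$; $x\lhd x=x$; $x\lhd^{-1}x=x$. The empty quandle is allowed (so $Q_0=\emptyset$). Quandle morphisms are maps preserving both operations. We write $\lhd^{1}=\lhd$, and $a\lhd^{\epsilon_1}b_1\lhd^{\epsilon_2}\cdots\lhd^{\epsilon_m}b_m$ means $(\cdots((a\lhd^{\epsilon_1}b_1)\lhd^{\epsilon_2}b_2)\cdots)\lhd^{\epsilon_m}b_m$ (which is $a$ if $m=0$). For a quandle $M$, the (covariant) isotropy group $\mathcal{Z}_{\mathrm{Quandle}}(M)$ is the group of natural automorphisms of the projection functor $M/\mathrm{Quandle}\to\mathrm{Quandle}$ from the slice category under $M$. Its elements are the families $\pi=(\pi_h)_h$ of quandle automorphisms $\pi_h:\mathrm{cod}(h)\to\mathrm{cod}(h)$, one for each quandle morphism $h$ with domain $M$, such that $h'\circ\pi_h=\pi_{h'\circ h}\circ h'$ for all morphisms $h:M\to M'$ and $h':M'\to M''$. An automorphism $h$ of $M$ is a categorical inner automorphism if $h=\pi_{\mathrm{id}_M}$ for some $\pi\in\mathcal{Z}_{\mathrm{Quandle}}(M)$. The group of algebraic inner automorphisms of a quandle $Q$ is the subgroup of $\mathrm{Aut}(Q)$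 generated by the automorphisms $(-)\lhd r$, $r\in Q$; explicitly, $f\in \mathrm{Aut}(Q)$ is an algebraic inner automorphism iff there are $k\ge0$, $q_1,\dots,q_k\in Q$ and $\epsilon_1,\dots,\epsilon_k=\pm1$ with $f(q)=q\lhd^{\epsilon_1}q_1\lhd^{\epsilon_2}\cdots\lhd^{\epsilon_k}q_k$ for all $q\in Q$. A group word $y_{i_1}^{\epsilon_1}\cdots y_{i_m}^{\epsilon_m}$ ($m\ge0$, $1\le i_j\le n$, $\epsilon_j=\pm1$) is reduced if $y_{i_j}=y_{i_{j+1}}$ implies $\epsilon_j=\epsilon_{j+1}$ for all $1\le j<m$ (the empty word counts as reduced).
   Formalization: In part 2 uniqueness of the word is claimed only for n ≠ 1 (on the one-element quandle Q_1 every word acts as the identity, so it fails); for n = 1 only existence is claimed. Quandles range over those with carrier inside an arbitrary infinite set. *)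

theory Defs
  imports "HOL-Algebra.Algebra"
begin

record 'a quandle = "'a partial_object" +
  qop :: "['a, 'a] \<Rightarrow> 'a" (infixl \<open>\<triangleleft>\<index>\<close> 70)
  qinv :: "['a, 'a] \<Rightarrow> 'a" (infixl \<open>\<triangleleft>\<inverse>\<index>\<close> 70)

text \<open>The carrier may be empty.\<close>

locale quandle =
  fixes Q (structure)
  assumes qop_closed: "\<lbrakk>x \<in> carrier Q; y \<in> carrier Q\<rbrakk> \<Longrightarrow> x \<triangleleft> y \<in> carrier Q"
    and qinv_closed: "\<lbrakk>x \<in> carrier Q; y \<in> carrier Q\<rbrakk> \<Longrightarrow> x \<triangleleft>\<inverse> y \<in> carrier Q"
    and qop_distrib: "\<lbrakk>x \<in> carrier Q; y \<in> carrier Q; z \<in> carrier Q\<rbrakk>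
      \<Longrightarrow> (x \<triangleleft> y) \<triangleleft> z = (x \<triangleleft> z) \<triangleleft> (y \<triangleleft> z)"
    and qinv_distrib: "\<lbrakk>x \<in> carrier Q; y \<in> carrier Q; z \<in> carrier Q\<rbrakk>
      \<Longrightarrow> (x \<triangleleft>\<inverse> y) \<triangleleft>\<inverse> z = (x \<triangleleft>\<inverse> z) \<triangleleft>\<inverse> (y \<triangleleft>\<inverse> z)"
    and qop_qinv: "\<lbrakk>x \<in> carrier Q; y \<in> carrier Q\<rbrakk> \<Longrightarrow> (x \<triangleleft> y) \<triangleleft>\<inverse> y = x"
    and qinv_qop: "\<lbrakk>x \<in> carrier Q; y \<in> carrier Q\<rbrakk> \<Longrightarrow> (x \<triangleleft>\<inverse> y) \<triangleleft> y = x"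
    and qop_idem: "x \<in> carrier Q \<Longrightarrow> x \<triangleleft> x = x"
    and qinv_idem: "x \<in> carrier Q \<Longrightarrow> x \<triangleleft>\<inverse> x = x"

text \<open>Morphisms are extensional functions, so that equality of morphisms is equality of the
  underlying maps between the carriers; they are composed with \<^const>\<open>compose\<close>.\<close>

definition quandle_hom :: "('a, 'm) quandle_scheme \<Rightarrow> ('b, 'k) quandle_scheme \<Rightarrow> ('a \<Rightarrow> 'b) set"
  where "quandle_hom Q R = {h \<in> carrier Q \<rightarrow>\<^sub>E carrier R. \<forall>x\<in>carrier Q. \<forall>y\<in>carrier Q.
    h (x \<triangleleft>\<^bsub>Q\<^esub> y) = h x \<triangleleft>\<^bsub>R\<^esub> h y \<and> h (x \<triangleleft>\<inverse>\<^bsub>Q\<^esub> y) = h x \<triangleleft>\<inverse>\<^bsub>R\<^esub> h y}"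

definition quandle_aut :: "('a, 'm) quandle_scheme \<Rightarrow> ('a \<Rightarrow> 'a) monoid"
  where "quandle_aut Q =
    \<lparr>carrier = {h \<in> quandle_hom Q Q. bij_betw h (carrier Q) (carrier Q)},
     monoid.mult = compose (carrier Q), one = (\<lambda>x\<in>carrier Q. x)\<rparr>"

text \<open>The category of (small) quandles is modelled by the quandles whose carrier is a subset of a
  fixed but arbitrary type \<open>'u\<close>, which plays the role of the universe.  When \<open>'u\<close> is infinite, it
  contains all finitely generated free quandles.  The objects of the slice
  category under \<open>M\<close> are the pairs of a codomain \<open>Q\<close> and a morphism from \<open>M\<close> to \<open>Q\<close>.\<close>

definition quandles_under :: "'u quandle \<Rightarrow> ('u quandle \<times> ('u \<Rightarrow> 'u)) set"
  where "quandles_under M = {(Q, h). quandle Q \<and> h \<in> quandle_hom M Q}"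

definition endo_families :: "'u quandle \<Rightarrow> ('u quandle \<times> ('u \<Rightarrow> 'u) \<Rightarrow> 'u \<Rightarrow> 'u) set"
  where "endo_families M = (\<Pi>\<^sub>E (Q, h)\<in>quandles_under M. quandle_hom Q Q)"

definition isotropy_group :: "'u quandle \<Rightarrow> ('u quandle \<times> ('u \<Rightarrow> 'u) \<Rightarrow> 'u \<Rightarrow> 'u) monoid"
  where "isotropy_group M =
    \<lparr>carrier = {\<pi> \<in> (\<Pi>\<^sub>E (Q, h)\<in>quandles_under M. carrier (quandle_aut Q)).
       \<forall>(Q, h)\<in>quandles_under M. \<forall>R h'. quandle R \<and> h' \<in> quandle_hom Q R \<longrightarrow>
         compose (carrier Q) h' (\<pi> (Q, h)) =
         compose (carrier Q) (\<pi> (R, compose (carrier M) h' h)) h'},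
     monoid.mult = (\<lambda>\<pi> \<rho>. \<lambda>(Q, h)\<in>quandles_under M. \<pi> (Q, h) \<otimes>\<^bsub>quandle_aut Q\<^esub> \<rho> (Q, h)),
     one = (\<lambda>(Q, h)\<in>quandles_under M. \<one>\<^bsub>quandle_aut Q\<^esub>)\<rparr>"

definition categorical_inner :: "'u quandle \<Rightarrow> ('u \<Rightarrow> 'u) set"
  where "categorical_inner M = {h \<in> carrier (quandle_aut M).
    \<exists>\<pi>\<in>carrier (isotropy_group M). h = \<pi> (M, \<lambda>x\<in>carrier M. x)}"

definition algebraic_inner :: "('a, 'm) quandle_scheme \<Rightarrow> ('a \<Rightarrow> 'a) set"
  where "algebraic_inner Q =
    generate (quandle_aut Q) {\<lambda>q\<in>carrier Q. q \<triangleleft>\<^bsub>Q\<^esub> r | r. r \<in> carrier Q}"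

text \<open>\<open>F\<close> is the free quandle on \<open>y 1, \<dots>, y n\<close>: its universal property in the category of
  quandles with carrier in \<open>'u\<close>.\<close>

definition free_quandle :: "nat \<Rightarrow> (nat \<Rightarrow> 'u) \<Rightarrow> 'u quandle \<Rightarrow> bool"
  where "free_quandle n y F \<longleftrightarrow> quandle F \<and> y \<in> {1..n} \<rightarrow> carrier F \<and>
    (\<forall>R :: 'u quandle. quandle R \<longrightarrow> (\<forall>g \<in> {1..n} \<rightarrow> carrier R.
       \<exists>!h. h \<in> quandle_hom F R \<and> (\<forall>i\<in>{1..n}. h (y i) = g i)))"

text \<open>The letter \<open>(i, True)\<close> stands for \<open>y\<^sub>i\<close> with exponent \<open>1\<close>, and \<open>(i, False)\<close> for \<open>y\<^sub>i\<close> with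
  exponent \<open>-1\<close>.\<close>

definition reduced_words :: "nat \<Rightarrow> (nat \<times> bool) list set"
  where "reduced_words n = {w. fst ` set w \<subseteq> {1..n} \<and>
    (\<forall>j. Suc j < length w \<longrightarrow> fst (w ! j) = fst (w ! Suc j) \<longrightarrow> snd (w ! j) = snd (w ! Suc j))}"

fun word_act :: "('a, 'm) quandle_scheme \<Rightarrow> (nat \<Rightarrow> 'a) \<Rightarrow> 'a \<Rightarrow> (nat \<times> bool) list \<Rightarrow> 'a" where
  "word_act Q b q [] = q"
| "word_act Q b q ((i, e) # w) =
     word_act Q b (if e then q \<triangleleft>\<^bsub>Q\<^esub> b i else q \<triangleleft>\<inverse>\<^bsub>Q\<^esub> b i) w"

text \<open>The free quandle on one generator has a single element, so there every word acts as the
  identity; uniqueness of a word that describes an endomorphism of the free quandle itself (and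
  not a whole family) can therefore only hold for \<open>n \<noteq> 1\<close>.\<close>

end

(* A natural automorphism is determined by its value at the generic element, the generator x of the
   free quandle on x, y_1, ..., y_n; this value is a generator acted upon by a word W in
   x, y_1, ..., y_n, and testing on trivial quandles shows that the generator is x.  To remove x
   from W, test the resulting operation t on the quandle G + G, where G is the free group: the first
   copy carries conjugation and acts on the second copy by right translation, while the second copy
   acts trivially.  On the second copy t is translation by the word V obtained from W by deleting x,
   so the homomorphism property t(p <| x) = t(p) <| t(x) gives V^-1 x V = W^-1 x W in G.  Comparing
   the reduced forms of both sides, W = x^k V in G, and the factor x^k acts trivially on x.  The same
   quandle detects the reduced word of a natural automorphism, and for n >= 2 conjugation of two
   different generators detects it already on the free quandle. *)

theory Submission
  imports Defs "HOL-Library.Countable_Set"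
begin

section \<open>Free groups: reduced words as normal forms, and conjugates of generators\<close>

section \<open>Reduced words\<close>

definition flip :: "'a \<times> bool \<Rightarrow> 'a \<times> bool"
  where "flip l = (fst l, \<not> snd l)"

definition winv :: "('a \<times> bool) list \<Rightarrow> ('a \<times> bool) list"
  where "winv w = rev (map flip w)"

abbreviation reduced :: "('a \<times> bool) list \<Rightarrow> bool"
  where "reduced \<equiv> successively (\<lambda>l m. m \<noteq> flip l)"

text \<open>Left multiplication by a letter, on reduced words. Folding it over a word lets the free
  group act on its normal forms, as in van der Waerden's argument, so no confluence proof for
  cancellation is required.\<close>

fun push :: "'a \<times> bool \<Rightarrow> ('a \<times> bool) list \<Rightarrow> ('a \<times> bool) list" where
  "push l [] = [l]"
| "push l (m # w) = (if m = flip l then w else l # m # w)"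

definition reduce :: "('a \<times> bool) list \<Rightarrow> ('a \<times> bool) list"
  where "reduce w = foldr push w []"

lemma reduce_Nil [simp]: "reduce [] = []"
  by (simp add: reduce_def)

lemma flip_flip [simp]: "flip (flip l) = l"
  by (simp add: flip_def)

lemma flip_simps [simp]: "flip (i, e) = (i, \<not> e)" "fst (flip l) = fst l" "snd (flip l) = (\<not> snd l)"
  by (simp_all add: flip_def)

lemma winv_simps [simp]:
  "winv [] = []" "winv (l # w) = winv w @ [flip l]" "winv (u @ v) = winv v @ winv u"
  "length (winv w) = length w" "fst ` set (winv w) = fst ` set w"
  by (simp_all add: winv_def image_image)

lemma winv_winv [simp]: "winv (winv w) = w"
  by (simp add: winv_def rev_map o_def)

lemma reduced_push: "reduced w \<Longrightarrow> reduced (push l w)"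
  by (cases w) (auto simp: successively_Cons)

lemma reduced_reduce [simp]: "reduced (reduce w)"
  unfolding reduce_def by (induction w) (auto simp: reduced_push)

lemma push_reduced: "reduced (l # w) \<Longrightarrow> push l w = l # w"
  by (cases w) auto

lemma reduce_reduced: "reduced w \<Longrightarrow> reduce w = w"
proof (induction w)
  case (Cons l w)
  then have "reduce w = w" by (auto simp: successively_Cons)
  then show ?case using push_reduced[OF Cons.prems] by (simp add: reduce_def)
qed (simp add: reduce_def)

lemma reduce_reduce [simp]: "reduce (reduce w) = reduce w"
  by (simp add: reduce_reduced)

text \<open>If \<open>push l\<close> cancels the head of \<open>w\<close>, reducedness keeps
  \<open>l\<close> from being the next letter, so \<open>push (flip l)\<close> restores the head.
  Thus letters permute the reduced words.\<close>

lemma push_flip_push: "reduced w \<Longrightarrow> push (flip l) (push l w) = w"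
  by (cases w; cases "tl w") (auto simp: successively_Cons)

text \<open>Letters permute the reduced words and \<open>flip l\<close> undoes \<open>l\<close>, so
  a cancellation inside \<open>u\<close> leaves the composite permutation unchanged.\<close>

lemma foldr_push_reduce: "reduced s \<Longrightarrow> foldr push (reduce u) s = foldr push u s"
proof (induction u)
  case (Cons l u)
  have s: "reduced (foldr push v s)" for v
    using Cons.prems by (induction v) (auto simp: reduced_push)
  have "foldr push (push l r) s = push l (foldr push r s)" for r
  proof (cases r)
    case (Cons m r')
    then show ?thesis using push_flip_push[OF s[of r'], of "flip l"] by auto
  qed simp
  then show ?case using Cons by (simp add: reduce_def)
qed (simp add: reduce_def)

lemma reduce_append: "reduce (u @ v) = foldr push u (reduce v)"
  by (simp add: reduce_def)

lemma reduce_reduce_left [simp]: "reduce (reduce u @ v) = reduce (u @ v)"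
  by (simp add: reduce_append foldr_push_reduce)

lemma reduce_reduce_middle [simp]: "reduce (u @ reduce v @ w) = reduce (u @ v @ w)"
  by (metis reduce_append reduce_reduce_left)

lemma reduce_reduce_right [simp]: "reduce (u @ reduce v) = reduce (u @ v)"
  by (simp add: reduce_append)

lemma reduce_cong_append: "reduce v = reduce w \<Longrightarrow> reduce (u @ v) = reduce (u @ w)"
  by (simp add: reduce_append)

lemma reduce_flip_cancel: "reduce (flip l # l # v) = reduce v"
  using push_flip_push[of "reduce v" l] by (simp add: reduce_def[of "_ # _"] flip: reduce_def)

lemma reduce_winv_cancel [simp]: "reduce (winv u @ u @ v) = reduce v"
proof (induction u)
  case (Cons l u)
  have "reduce (winv u @ flip l # l # u @ v) = reduce (winv u @ u @ v)"
    by (rule reduce_cong_append) (rule reduce_flip_cancel)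
  then show ?case using Cons by simp
qed simp

lemma reduce_winv_cancel' [simp]: "reduce (u @ winv u @ v) = reduce v"
  using reduce_winv_cancel[of "winv u" v] by simp

lemma reduce_winv_cancel_middle [simp]:
  "reduce (a @ winv u @ u @ v) = reduce (a @ v)" "reduce (a @ u @ winv u @ v) = reduce (a @ v)"
  by (rule reduce_cong_append, simp)+

lemma reduce_winv_cancel_end [simp]:
  "reduce (a @ winv u @ u) = reduce a" "reduce (a @ u @ winv u) = reduce a"
  using reduce_winv_cancel_middle[of a u "[]"] by simp_all

lemma set_reduce: "set (reduce w) \<subseteq> set w"
proof (induction w)
  case (Cons l w)
  have "set (push l v) \<subseteq> insert l (set v)" for v by (cases v) auto
  then show ?case using Cons by (fastforce simp: reduce_def)
qed (simp add: reduce_def)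

lemma reduced_winv [simp]: "reduced (winv w) \<longleftrightarrow> reduced w"
  by (simp add: winv_def successively_map) (rule successively_cong, auto)

text \<open>Uniqueness of inverses: a product with \<open>reduce u\<close> in the middle is
  cancelled once on the left and once on the right.\<close>

lemma winv_reduce [simp]: "winv (reduce u) = reduce (winv u)"
proof -
  have "reduce (winv u) = reduce (winv (reduce u) @ reduce u @ winv u)"
    by (simp only: reduce_winv_cancel)
  also have "\<dots> = reduce (winv (reduce u) @ u @ winv u)"
    by (simp only: reduce_reduce_middle)
  also have "\<dots> = winv (reduce u)"
    by (simp only: reduce_winv_cancel_end reduced_winv reduced_reduce reduce_reduced)
  finally show ?thesis by simp
qed

lemma reduced_words_eq: "reduced_words n = {w. fst ` set w \<subseteq> {1..n} \<and> reduced w}"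
  unfolding reduced_words_def successively_conv_nth
  by (auto simp: prod_eq_iff)

text \<open>Selects a representative of the coset of \<open>w\<close> modulo left multiplication by
  powers of letter \<open>i\<close>; these powers are the ambiguity left when \<open>i\<close> is
  conjugated by \<open>w\<close>.\<close>

abbreviation strip :: "'a \<Rightarrow> ('a \<times> bool) list \<Rightarrow> ('a \<times> bool) list"
  where "strip i \<equiv> dropWhile (\<lambda>l. fst l = i)"

text \<open>Both neighbours of the middle letter have an index other than \<open>i\<close>, so
  nothing can cancel there.\<close>

lemma reduced_conj:
  assumes "reduced w" and "w = [] \<or> fst (hd w) \<noteq> i"
  shows "reduced (winv w @ (i, e) # w)"
proof (cases w)
  case (Cons l v)
  have "(i, e) \<noteq> flip (last (winv w))" "hd w \<noteq> flip (i, e)" using Cons assms(2) by auto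
  moreover have "reduced (winv w)" using assms(1) by simp
  ultimately show ?thesis using assms(1) Cons
    unfolding successively_append_iff successively_Cons[of _ _ w] by (simp del: reduced_winv)
qed simp

text \<open>Leading letters of index \<open>i\<close> commute with \<open>(i, e)\<close> and
  disappear one by one; what then remains is reduced by \<open>reduced_conj\<close>.\<close>

lemma reduce_conj:
  assumes "reduced w"
  shows "reduce (winv w @ (i, e) # w) = winv (strip i w) @ (i, e) # strip i w"
  using assms
proof (induction w)
  case (Cons l w)
  show ?case
  proof (cases "fst l = i")
    case True
    \<comment> \<open>The letter \<open>(i, e)\<close> cancels to its left if
      \<open>l = (i, e)\<close> and to its right if \<open>l = flip (i, e)\<close>; either way one
      copy of \<open>(i, e)\<close> survives.\<close>
    have "reduce (flip l # (i, e) # l # w) = reduce ((i, e) # w)"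
    proof (cases "l = (i, e)")
      case True
      then show ?thesis using reduce_flip_cancel[of l "(i, e) # w"] by simp
    next
      case False
      with True have "l = flip (i, e)" by (cases l) auto
      then show ?thesis
        using reduce_cong_append[OF reduce_flip_cancel[of l w], of "[(i, e)]"] by simp
    qed
    then have "reduce (winv w @ flip l # (i, e) # l # w) = reduce (winv w @ (i, e) # w)"
      by (rule reduce_cong_append)
    moreover have "reduced w" using Cons.prems by (auto simp: successively_Cons)
    ultimately show ?thesis using True Cons.IH by simp
  next
    case False
    then show ?thesis using reduce_reduced[OF reduced_conj[OF Cons.prems]] by simp
  qed
qed (simp add: reduce_def)

text \<open>Equal conjugates have equal normal forms, and their common length fixes the position of
  the middle letter, so the right halves agree.\<close>

lemma conj_eq_strip:
  assumes "reduced v" "reduced w"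
    and "reduce (winv v @ (i, e) # v) = reduce (winv w @ (i, e) # w)"
  shows "strip i v = strip i w"
proof -
  let ?v = "strip i v" and ?w = "strip i w"
  have eq: "winv ?v @ (i, e) # ?v = winv ?w @ (i, e) # ?w"
    using assms by (simp add: reduce_conj)
  from arg_cong[OF this, of length] have "length (winv ?v) = length (winv ?w)" by simp
  with eq show ?thesis by (simp add: append_eq_append_conv)
qed

text \<open>A word cannot begin with both \<open>i\<close> and \<open>j\<close>, so one of the two
  strips leaves it unchanged. If different strips do this for \<open>v\<close> and \<open>w\<close>,
  comparing lengths shows that nothing was removed.\<close>

lemma conj_inj:
  assumes "i \<noteq> j" and red: "reduced v" "reduced w"
    and i: "reduce (winv v @ (i, True) # v) = reduce (winv w @ (i, True) # w)"
    and j: "reduce (winv v @ (j, True) # v) = reduce (winv w @ (j, True) # w)"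
  shows "v = w"
proof -
  have s: "strip i v = strip i w" "strip j v = strip j w"
    using conj_eq_strip[OF red i] conj_eq_strip[OF red j] by simp_all
  have len: "length (strip k u) \<le> length u" for k :: 'a and u :: "('a \<times> bool) list"
    by (rule length_dropWhile_le)
  have one: "strip i u = u \<or> strip j u = u" for u :: "('a \<times> bool) list"
    using \<open>i \<noteq> j\<close> by (cases u) auto
  have less: "strip k u = u \<or> length (strip k u) < length u" for k :: 'a and u :: "('a \<times> bool) list"
    by (induction u) (auto simp: less_Suc_eq)
  show ?thesis
    using s one[of v] one[of w] less[of i v] less[of j v] less[of i w] less[of j w] by auto
qed

section \<open>Group words acting on a quandle by automorphisms\<close>

section \<open>Words acting on quandles\<close>

context quandle
begin

text \<open>Right multiplication by \<open>z\<close> preserves \<open><|\<close>; applying this to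
  \<open>x <|^-1 y\<close> and cancelling shows that it preserves the inverse operation too.\<close>

lemma qinv_qop_distrib:
  assumes "x \<in> carrier Q" "y \<in> carrier Q" "z \<in> carrier Q"
  shows "(x \<triangleleft>\<inverse> y) \<triangleleft> z = (x \<triangleleft> z) \<triangleleft>\<inverse> (y \<triangleleft> z)"
  using assms qop_distrib[of "x \<triangleleft>\<inverse> y" y z] by (metis qinv_closed qop_closed qop_qinv qinv_qop)

lemma qop_qinv_distrib:
  assumes "x \<in> carrier Q" "y \<in> carrier Q" "z \<in> carrier Q"
  shows "(x \<triangleleft> y) \<triangleleft>\<inverse> z = (x \<triangleleft>\<inverse> z) \<triangleleft> (y \<triangleleft>\<inverse> z)"
  using assms qinv_distrib[of "x \<triangleleft> y" y z] by (metis qinv_closed qop_closed qop_qinv qinv_qop)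

lemma word_act_closed:
  "\<lbrakk>q \<in> carrier Q; b \<in> fst ` set w \<rightarrow> carrier Q\<rbrakk> \<Longrightarrow> word_act Q b q w \<in> carrier Q"
  by (induction w arbitrary: q) (auto simp: qop_closed qinv_closed Pi_iff)

lemma word_act_append: "word_act Q b q (u @ v) = word_act Q b (word_act Q b q u) v"
  by (induction u arbitrary: q) auto

lemma word_act_cancel:
  "\<lbrakk>q \<in> carrier Q; b i \<in> carrier Q\<rbrakk> \<Longrightarrow> word_act Q b q ((i, e) # (i, \<not> e) # w) = word_act Q b q w"
  by (simp add: qop_qinv qinv_qop)

lemma word_act_reduce:
  "\<lbrakk>q \<in> carrier Q; b \<in> fst ` set w \<rightarrow> carrier Q\<rbrakk> \<Longrightarrow> word_act Q b q (reduce w) = word_act Q b q w"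
proof (induction w arbitrary: q)
  case (Cons l w)
  obtain i e where l: "l = (i, e)" by (cases l)
  have "word_act Q b q (push l v) = word_act Q b q (l # v)" for v
    using Cons.prems word_act_cancel[of q b i e] unfolding l by (cases v) auto
  then have "word_act Q b q (reduce (l # w)) = word_act Q b q (l # reduce w)"
    by (simp add: reduce_def)
  also have "\<dots> = word_act Q b q (l # w)"
    using Cons by (auto simp: l qop_closed qinv_closed Pi_iff)
  finally show ?case .
qed (simp add: reduce_def)

lemma word_act_winv:
  assumes "q \<in> carrier Q" "b \<in> fst ` set w \<rightarrow> carrier Q"
  shows "word_act Q b (word_act Q b q w) (winv w) = q" "word_act Q b (word_act Q b q (winv w)) w = q"
proof -
  have "b \<in> fst ` set (w @ winv w) \<rightarrow> carrier Q" "b \<in> fst ` set (winv w @ w) \<rightarrow> carrier Q"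
    using assms by (auto simp: image_Un Pi_iff simp flip: image_image)
  from this[THEN word_act_reduce[OF assms(1)]]
  show "word_act Q b (word_act Q b q w) (winv w) = q" "word_act Q b (word_act Q b q (winv w)) w = q"
    using reduce_winv_cancel[of w "[]"] reduce_winv_cancel'[of w "[]"]
    by (simp_all add: word_act_append reduce_def)
qed

lemma word_act_distrib:
  assumes "x \<in> carrier Q" "z \<in> carrier Q" "b \<in> fst ` set w \<rightarrow> carrier Q"
  shows "word_act Q b (x \<triangleleft> z) w = word_act Q b x w \<triangleleft> word_act Q b z w"
    and "word_act Q b (x \<triangleleft>\<inverse> z) w = word_act Q b x w \<triangleleft>\<inverse> word_act Q b z w"
proof -
  have "word_act Q b (x \<triangleleft> z) w = word_act Q b x w \<triangleleft> word_act Q b z w \<and>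
    word_act Q b (x \<triangleleft>\<inverse> z) w = word_act Q b x w \<triangleleft>\<inverse> word_act Q b z w"
    using assms
  proof (induction w arbitrary: x z)
    case (Cons l w)
    obtain i e where l: "l = (i, e)" by (cases l)
    have "b i \<in> carrier Q" "b \<in> fst ` set w \<rightarrow> carrier Q" using Cons.prems(3) by (auto simp: l)
    with Cons.prems(1,2) Cons.IH show ?case unfolding l
      by (cases e) (simp_all add: qop_closed qinv_closed qop_distrib[of x z "b i"]
          qinv_distrib[of x z "b i"] qinv_qop_distrib[of x z "b i"] qop_qinv_distrib[of x z "b i"])
  qed simp
  then show "word_act Q b (x \<triangleleft> z) w = word_act Q b x w \<triangleleft> word_act Q b z w"
    "word_act Q b (x \<triangleleft>\<inverse> z) w = word_act Q b x w \<triangleleft>\<inverse> word_act Q b z w" by simp_all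
qed

text \<open>Write \<open>x\<close> as \<open>x\<close> acted upon by \<open>winv v\<close> and then
  by \<open>v\<close>, and distribute \<open>v\<close>: the translate of \<open>b i\<close> by
  \<open>v\<close> acts as a conjugate of letter \<open>i\<close>. Hence products of translated
  generators are again translated generators.\<close>

lemma qop_word_act:
  assumes "x \<in> carrier Q" "b \<in> insert i (fst ` set v) \<rightarrow> carrier Q"
  shows "x \<triangleleft> word_act Q b (b i) v = word_act Q b x (winv v @ (i, True) # v)"
    and "x \<triangleleft>\<inverse> word_act Q b (b i) v = word_act Q b x (winv v @ (i, False) # v)"
proof -
  have "b \<in> fst ` set v \<rightarrow> carrier Q" "b \<in> fst ` set (winv v) \<rightarrow> carrier Q" "b i \<in> carrier Q"
    using assms by (auto simp flip: image_image)
  with assms(1) show "x \<triangleleft> word_act Q b (b i) v = word_act Q b x (winv v @ (i, True) # v)"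
    "x \<triangleleft>\<inverse> word_act Q b (b i) v = word_act Q b x (winv v @ (i, False) # v)"
    by (simp_all add: word_act_append word_act_distrib word_act_closed word_act_winv)
qed

text \<open>By idempotence \<open>b i\<close> is fixed by every leading letter of index
  \<open>i\<close>.\<close>

lemma word_act_strip:
  "b i \<in> carrier Q \<Longrightarrow> word_act Q b (b i) (strip i w) = word_act Q b (b i) w"
  by (induction w) (auto simp: qop_idem qinv_idem)

lemma word_act_hom:
  assumes "f \<in> quandle_hom Q R" "q \<in> carrier Q" "b \<in> fst ` set w \<rightarrow> carrier Q"
  shows "f (word_act Q b q w) = word_act R (\<lambda>i. f (b i)) (f q) w"
  using assms(2,3)
proof (induction w arbitrary: q)
  case (Cons l w)
  then show ?case using assms(1)
    by (cases l) (auto simp: quandle_hom_def qop_closed qinv_closed Pi_iff)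
qed simp

text \<open>The inverse map is the action of \<open>winv w\<close>, and distributivity makes the
  action a morphism.\<close>

lemma word_act_aut:
  assumes "b \<in> fst ` set w \<rightarrow> carrier Q"
  shows "(\<lambda>q\<in>carrier Q. word_act Q b q w) \<in> carrier (quandle_aut Q)"
proof -
  have "bij_betw (\<lambda>q\<in>carrier Q. word_act Q b q w) (carrier Q) (carrier Q)"
  proof (rule bij_betw_byWitness[where f' = "\<lambda>q. word_act Q b q (winv w)"])
    have "b \<in> fst ` set (winv w) \<rightarrow> carrier Q" using assms by simp
    with assms show "(\<lambda>q. word_act Q b q (winv w)) ` carrier Q \<subseteq> carrier Q"
      "\<forall>a'\<in>carrier Q. (\<lambda>q\<in>carrier Q. word_act Q b q w) (word_act Q b a' (winv w)) = a'"
      by (auto simp: word_act_closed word_act_winv)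
  qed (use assms in \<open>auto simp: word_act_winv word_act_closed\<close>)
  then show ?thesis using assms
    by (auto simp: quandle_aut_def quandle_hom_def word_act_closed word_act_distrib
        qop_closed qinv_closed)
qed

end

lemma word_act_cong: "(\<And>i. i \<in> fst ` set w \<Longrightarrow> b i = c i) \<Longrightarrow> word_act Q b q w = word_act Q c q w"
  by (induction w arbitrary: q) auto

section \<open>Morphisms of quandles, and copies of countable quandles inside the universe\<close>

section \<open>Homomorphisms\<close>

lemma quandle_homI:
  assumes "\<And>x. x \<in> carrier Q \<Longrightarrow> f x \<in> carrier R"
    and "\<And>x y. \<lbrakk>x \<in> carrier Q; y \<in> carrier Q\<rbrakk> \<Longrightarrow> f (x \<triangleleft>\<^bsub>Q\<^esub> y) = f x \<triangleleft>\<^bsub>R\<^esub> f y"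
    and "\<And>x y. \<lbrakk>x \<in> carrier Q; y \<in> carrier Q\<rbrakk> \<Longrightarrow> f (x \<triangleleft>\<inverse>\<^bsub>Q\<^esub> y) = f x \<triangleleft>\<inverse>\<^bsub>R\<^esub> f y"
    and "quandle Q"
  shows "restrict f (carrier Q) \<in> quandle_hom Q R"
  using assms quandle.qop_closed[of Q] quandle.qinv_closed[of Q] by (auto simp: quandle_hom_def)

lemma quandle_homD:
  assumes "f \<in> quandle_hom Q R"
  shows "f \<in> extensional (carrier Q)"
    and "x \<in> carrier Q \<Longrightarrow> f x \<in> carrier R"
    and "\<lbrakk>x \<in> carrier Q; y \<in> carrier Q\<rbrakk> \<Longrightarrow> f (x \<triangleleft>\<^bsub>Q\<^esub> y) = f x \<triangleleft>\<^bsub>R\<^esub> f y"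
    and "\<lbrakk>x \<in> carrier Q; y \<in> carrier Q\<rbrakk> \<Longrightarrow> f (x \<triangleleft>\<inverse>\<^bsub>Q\<^esub> y) = f x \<triangleleft>\<inverse>\<^bsub>R\<^esub> f y"
  using assms by (auto simp: quandle_hom_def PiE_iff)

lemma compose_hom:
  assumes "quandle Q" "f \<in> quandle_hom Q R" "g \<in> quandle_hom R S"
  shows "compose (carrier Q) g f \<in> quandle_hom Q S"
  unfolding compose_def using assms by (intro quandle_homI) (auto simp: quandle_homD)

lemma id_hom: "quandle Q \<Longrightarrow> (\<lambda>x\<in>carrier Q. x) \<in> quandle_hom Q Q"
  by (rule quandle_homI) auto

text \<open>Freeness and naturality speak only of quandles with carrier in \<open>'u\<close>.
  Transport of structure along an injection into the infinite type brings countable test quandles of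
  other types within reach.\<close>

lemma quandle_copy:
  fixes R :: "('b, 'm) quandle_scheme"
  assumes "infinite (UNIV :: 'u set)" "quandle R" "countable (carrier R)"
  obtains R' :: "'u quandle" and f g where "quandle R'" "f \<in> quandle_hom R R'" "g \<in> quandle_hom R' R"
    "\<And>x. x \<in> carrier R \<Longrightarrow> g (f x) = x"
proof -
  interpret quandle R by fact
  obtain k :: "nat \<Rightarrow> 'u" where k: "inj k"
    using assms(1) infinite_countable_subset by blast
  define e where "e = k \<circ> to_nat_on (carrier R)"
  define d where "d = inv_into (carrier R) e"
  have "inj_on e (carrier R)"
    unfolding e_def using assms(3) k by (blast intro: comp_inj_on inj_on_to_nat_on inj_on_subset)
  then have de [simp]: "d (e x) = x" if "x \<in> carrier R" for x
    using that by (simp add: d_def)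
  define R' where "R' = \<lparr>carrier = e ` carrier R, qop = \<lambda>x y. e (d x \<triangleleft>\<^bsub>R\<^esub> d y),
    qinv = \<lambda>x y. e (d x \<triangleleft>\<inverse>\<^bsub>R\<^esub> d y)\<rparr>"
  have R': "quandle R'"
    by unfold_locales
      (auto simp: R'_def qop_closed qinv_closed qop_qinv qinv_qop qop_idem qinv_idem
        simp flip: qop_distrib qinv_distrib)
  show ?thesis
  proof (rule that[OF R'])
    show "restrict e (carrier R) \<in> quandle_hom R R'"
      by (rule quandle_homI) (auto simp: R'_def assms)
    show "restrict d (carrier R') \<in> quandle_hom R' R"
      by (rule quandle_homI[OF _ _ _ R']) (auto simp: R'_def qop_closed qinv_closed)
  qed (auto simp: R'_def)
qed

section \<open>Free objects as terms modulo equality under all valuations\<close>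

section \<open>Relatively free quandles\<close>

definition valuations :: "nat set \<Rightarrow> ('u quandle \<times> (nat \<Rightarrow> 'u)) set"
  where "valuations A = {(Q, b). quandle Q \<and> b \<in> A \<rightarrow> carrier Q}"

text \<open>By \<open>qop_word_act\<close> a generator followed by a word is a sufficiently general
  term. It is encoded as the function of its values, so identifying equivalent terms requires no
  quotient.\<close>

definition term_value :: "nat set \<Rightarrow> nat \<Rightarrow> (nat \<times> bool) list \<Rightarrow> 'u quandle \<times> (nat \<Rightarrow> 'u) \<Rightarrow> 'u"
  where "term_value A i w = (\<lambda>(Q, b)\<in>valuations A. word_act Q b (b i) w)"

text \<open>Two terms are identified when all valuations in quandles with
  carrier in \<open>'u\<close> agree on them.  Its carrier is countable, so it has a copy in \<open>'u\<close>.\<close>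

definition term_quandle :: "nat set \<Rightarrow> ('u quandle \<times> (nat \<Rightarrow> 'u) \<Rightarrow> 'u) quandle"
  where "term_quandle A =
    \<lparr>carrier = (\<lambda>(i, w). term_value A i w) ` (A \<times> {w. fst ` set w \<subseteq> A}),
     qop = \<lambda>u v. \<lambda>(Q, b)\<in>valuations A. u (Q, b) \<triangleleft>\<^bsub>Q\<^esub> v (Q, b),
     qinv = \<lambda>u v. \<lambda>(Q, b)\<in>valuations A. u (Q, b) \<triangleleft>\<inverse>\<^bsub>Q\<^esub> v (Q, b)\<rparr>"

lemma term_value_eq:
  "\<lbrakk>quandle Q; b \<in> A \<rightarrow> carrier Q\<rbrakk> \<Longrightarrow> term_value A i w (Q, b) = word_act Q b (b i) w"
  by (simp add: term_value_def valuations_def)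

lemma term_value_carrier: "\<lbrakk>i \<in> A; fst ` set w \<subseteq> A\<rbrakk> \<Longrightarrow> term_value A i w \<in> carrier (term_quandle A)"
  by (auto simp: term_quandle_def)

lemma term_quandleE:
  assumes "u \<in> carrier (term_quandle A)"
  obtains i w where "i \<in> A" "fst ` set w \<subseteq> A" "u = term_value A i w"
  using assms by (auto simp: term_quandle_def)

lemma term_quandle_ops:
  fixes u v :: "'u quandle \<times> (nat \<Rightarrow> 'u) \<Rightarrow> 'u"
  shows "u \<triangleleft>\<^bsub>term_quandle A\<^esub> v = (\<lambda>(Q, b)\<in>valuations A. u (Q, b) \<triangleleft>\<^bsub>Q\<^esub> v (Q, b))"
    and "u \<triangleleft>\<inverse>\<^bsub>term_quandle A\<^esub> v = (\<lambda>(Q, b)\<in>valuations A. u (Q, b) \<triangleleft>\<inverse>\<^bsub>Q\<^esub> v (Q, b))"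
  by (simp_all add: term_quandle_def)

lemma term_quandle_value:
  assumes "u \<in> carrier (term_quandle A)"
  shows "u \<in> extensional (valuations A)"
    and "(Q, b) \<in> valuations A \<Longrightarrow> u (Q, b) \<in> carrier Q"
proof -
  obtain i w where u: "i \<in> A" "fst ` set w \<subseteq> A" "u = term_value A i w"
    using assms by (rule term_quandleE)
  then show "u \<in> extensional (valuations A)" by (simp add: term_value_def)
  assume "(Q, b) \<in> valuations A"
  then have Q: "quandle Q" "b \<in> A \<rightarrow> carrier Q" by (simp_all add: valuations_def)
  with u have "b \<in> fst ` set w \<rightarrow> carrier Q" "b i \<in> carrier Q" by auto
  then show "u (Q, b) \<in> carrier Q"
    using Q u(3) by (simp add: term_value_eq quandle.word_act_closed)
qed

text \<open>The axioms hold pointwise. Closure is the part with content: \<open>qop_word_act\<close>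
  rewrites a product of two terms as a single term, uniformly in the valuation.\<close>

lemma quandle_term_quandle: "quandle (term_quandle A :: ('u quandle \<times> (nat \<Rightarrow> 'u) \<Rightarrow> 'u) quandle)"
proof
  fix u v :: "'u quandle \<times> (nat \<Rightarrow> 'u) \<Rightarrow> 'u"
  assume "u \<in> carrier (term_quandle A)" "v \<in> carrier (term_quandle A)"
  then obtain i w j x where u: "i \<in> A" "fst ` set w \<subseteq> A" "u = term_value A i w"
    and v: "j \<in> A" "fst ` set x \<subseteq> A" "v = term_value A j x"
    by (auto elim!: term_quandleE)
  have mem: "term_value A i (w @ winv x @ (j, e) # x) \<in> carrier (term_quandle A)" for e
    using u v by (intro term_value_carrier) (auto simp: image_Un simp flip: image_image)
  have "word_act Q b (b i) w \<triangleleft>\<^bsub>Q\<^esub> word_act Q b (b j) x = word_act Q b (b i) (w @ winv x @ (j, True) # x)"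
    "word_act Q b (b i) w \<triangleleft>\<inverse>\<^bsub>Q\<^esub> word_act Q b (b j) x = word_act Q b (b i) (w @ winv x @ (j, False) # x)"
    if "(Q, b) \<in> valuations A" for Q b
  proof -
    interpret quandle Q using that by (simp add: valuations_def)
    have "b \<in> insert j (fst ` set x) \<rightarrow> carrier Q" "word_act Q b (b i) w \<in> carrier Q"
      using that u v by (auto simp: valuations_def intro!: word_act_closed)
    from qop_word_act[OF this(2,1)] show
      "word_act Q b (b i) w \<triangleleft>\<^bsub>Q\<^esub> word_act Q b (b j) x = word_act Q b (b i) (w @ winv x @ (j, True) # x)"
      "word_act Q b (b i) w \<triangleleft>\<inverse>\<^bsub>Q\<^esub> word_act Q b (b j) x = word_act Q b (b i) (w @ winv x @ (j, False) # x)"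
      by (simp_all add: word_act_append)
  qed
  then have "u \<triangleleft>\<^bsub>term_quandle A\<^esub> v = term_value A i (w @ winv x @ (j, True) # x)"
    "u \<triangleleft>\<inverse>\<^bsub>term_quandle A\<^esub> v = term_value A i (w @ winv x @ (j, False) # x)"
    unfolding term_quandle_ops u(3) v(3) by (auto simp: term_value_def fun_eq_iff restrict_def)
  with mem show "u \<triangleleft>\<^bsub>term_quandle A\<^esub> v \<in> carrier (term_quandle A)"
    "u \<triangleleft>\<inverse>\<^bsub>term_quandle A\<^esub> v \<in> carrier (term_quandle A)" by simp_all
next
  fix u v w :: "'u quandle \<times> (nat \<Rightarrow> 'u) \<Rightarrow> 'u"
  let ?T = "term_quandle A :: ('u quandle \<times> (nat \<Rightarrow> 'u) \<Rightarrow> 'u) quandle"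
  have val: "t (Q, b) \<in> carrier Q" if "t \<in> carrier ?T" "(Q, b) \<in> valuations A" for t Q b
    using that by (rule term_quandle_value)
  have qdl: "quandle Q" if "(Q, b) \<in> valuations A" for Q and b :: "nat \<Rightarrow> 'u"
    using that by (simp add: valuations_def)
  \<comment> \<open>Elements of the carrier are extensional on \<open>valuations A\<close>, so their
    values there decide equality.\<close>
  have ext: "restrict s (valuations A) = t"
    if "t \<in> carrier ?T" "\<And>Q b. (Q, b) \<in> valuations A \<Longrightarrow> s (Q, b) = t (Q, b)" for s t
    using that term_quandle_value(1)[of t A] by (intro extensionalityI[of _ "valuations A"]) auto
  assume u: "u \<in> carrier ?T"
  show "u \<triangleleft>\<^bsub>?T\<^esub> u = u" "u \<triangleleft>\<inverse>\<^bsub>?T\<^esub> u = u"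
    unfolding term_quandle_ops
    by (intro ext[OF u]; simp add: quandle.qop_idem quandle.qinv_idem qdl val u)+
  assume v: "v \<in> carrier ?T"
  show "u \<triangleleft>\<^bsub>?T\<^esub> v \<triangleleft>\<inverse>\<^bsub>?T\<^esub> v = u" "u \<triangleleft>\<inverse>\<^bsub>?T\<^esub> v \<triangleleft>\<^bsub>?T\<^esub> v = u"
    unfolding term_quandle_ops
    by (intro ext[OF u]; simp add: quandle.qop_qinv quandle.qinv_qop qdl val u v)+
  assume w: "w \<in> carrier ?T"
  show "u \<triangleleft>\<^bsub>?T\<^esub> v \<triangleleft>\<^bsub>?T\<^esub> w = u \<triangleleft>\<^bsub>?T\<^esub> w \<triangleleft>\<^bsub>?T\<^esub> (v \<triangleleft>\<^bsub>?T\<^esub> w)"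
    unfolding term_quandle_ops
    by (rule restrict_ext) (clarsimp, rule quandle.qop_distrib[OF qdl], assumption, simp_all add: val u v w)
  show "u \<triangleleft>\<inverse>\<^bsub>?T\<^esub> v \<triangleleft>\<inverse>\<^bsub>?T\<^esub> w = u \<triangleleft>\<inverse>\<^bsub>?T\<^esub> w \<triangleleft>\<inverse>\<^bsub>?T\<^esub> (v \<triangleleft>\<inverse>\<^bsub>?T\<^esub> w)"
    unfolding term_quandle_ops
    by (rule restrict_ext) (clarsimp, rule quandle.qinv_distrib[OF qdl], assumption, simp_all add: val u v w)
qed

lemma countable_term_quandle: "countable (carrier (term_quandle A))"
  by (simp add: term_quandle_def)

text \<open>Evaluation at one valuation: this supplies the morphisms out of the term quandle that
  extend a prescribed choice of generators.\<close>

lemma term_value_hom: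
  assumes "quandle Q" "b \<in> A \<rightarrow> carrier Q"
  shows "(\<lambda>u\<in>carrier (term_quandle A). u (Q, b)) \<in> quandle_hom (term_quandle A) Q"
proof -
  have "(Q, b) \<in> valuations A" using assms by (simp add: valuations_def)
  then show ?thesis
    by (intro quandle_homI) (auto simp: term_quandle_ops term_quandle_value quandle_term_quandle)
qed

section \<open>A test quandle on two copies of a free group\<close>

section \<open>The translation quandle of a free group\<close>

definition act :: "('a \<times> bool) list + ('a \<times> bool) list \<Rightarrow> ('a \<times> bool) list \<Rightarrow>
    ('a \<times> bool) list + ('a \<times> bool) list"
  where "act x g = (case x of Inl a \<Rightarrow> Inl (reduce (winv g @ a @ g)) | Inr p \<Rightarrow> Inr (reduce (p @ g)))"

text \<open>The left summand is the free group under conjugation, the right summand the free group as a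
  set on which the left summand acts by right translation.\<close>

definition translation_quandle :: "(('a \<times> bool) list + ('a \<times> bool) list) quandle"
  where "translation_quandle =
    \<lparr>carrier = range reduce <+> range reduce,
     qop = \<lambda>x y. case y of Inl g \<Rightarrow> act x g | Inr _ \<Rightarrow> x,
     qinv = \<lambda>x y. case y of Inl g \<Rightarrow> act x (winv g) | Inr _ \<Rightarrow> x\<rparr>"

lemma carrier_translation_quandle:
  "Inl w \<in> carrier translation_quandle \<longleftrightarrow> reduce w = w"
  "Inr w \<in> carrier translation_quandle \<longleftrightarrow> reduce w = w"
  by (auto simp: translation_quandle_def) (metis InlI InrI rangeI)+

lemma translation_quandle_ops [simp]:
  "x \<triangleleft>\<^bsub>translation_quandle\<^esub> Inl g = act x g" "x \<triangleleft>\<^bsub>translation_quandle\<^esub> Inr p = x"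
  "x \<triangleleft>\<inverse>\<^bsub>translation_quandle\<^esub> Inl g = act x (winv g)" "x \<triangleleft>\<inverse>\<^bsub>translation_quandle\<^esub> Inr p = x"
  by (simp_all add: translation_quandle_def)

lemma act_simps [simp]:
  "act (Inl a) g = Inl (reduce (winv g @ a @ g))" "act (Inr p) g = Inr (reduce (p @ g))"
  by (simp_all add: act_def)

lemma act_reduce [simp]: "act x (reduce g) = act x g"
proof (cases x)
  case (Inl a)
  have "reduce ((winv g @ a) @ reduce g) = reduce ((winv g @ a) @ g)" by (rule reduce_reduce_right)
  then show ?thesis by (simp add: Inl)
qed simp

lemma act_append: "act (act x g) h = act x (g @ h)"
  by (cases x) simp_all

text \<open>In the group, \<open>k\<close> times \<open>k^-1 g k\<close> equals \<open>g k\<close>;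
  this is the self-distributivity of the test quandle.\<close>

lemma act_distrib: "act (act x k) (winv k @ g @ k) = act (act x g) k"
  unfolding act_append by (metis act_reduce reduce_winv_cancel')

text \<open>A group element is fixed under conjugation by itself, and the right copy acts trivially,
  so idempotence holds in both copies. Acting never changes the copy, so distributivity with an
  acting element from the right copy is immediate.\<close>

lemma quandle_translation_quandle: "quandle translation_quandle"
proof
  fix x y z :: "('a \<times> bool) list + ('a \<times> bool) list"
  assume x: "x \<in> carrier translation_quandle"
  then show "x \<triangleleft>\<^bsub>translation_quandle\<^esub> x = x" "x \<triangleleft>\<inverse>\<^bsub>translation_quandle\<^esub> x = x"
    by (cases x; simp add: carrier_translation_quandle)+
  assume y: "y \<in> carrier translation_quandle"
  with x show "x \<triangleleft>\<^bsub>translation_quandle\<^esub> y \<in> carrier translation_quandle"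
    "x \<triangleleft>\<inverse>\<^bsub>translation_quandle\<^esub> y \<in> carrier translation_quandle"
    "x \<triangleleft>\<^bsub>translation_quandle\<^esub> y \<triangleleft>\<inverse>\<^bsub>translation_quandle\<^esub> y = x"
    "x \<triangleleft>\<inverse>\<^bsub>translation_quandle\<^esub> y \<triangleleft>\<^bsub>translation_quandle\<^esub> y = x"
    by (cases x; cases y; simp add: carrier_translation_quandle)+
  assume z: "z \<in> carrier translation_quandle"
  show "x \<triangleleft>\<^bsub>translation_quandle\<^esub> y \<triangleleft>\<^bsub>translation_quandle\<^esub> z =
      x \<triangleleft>\<^bsub>translation_quandle\<^esub> z \<triangleleft>\<^bsub>translation_quandle\<^esub> (y \<triangleleft>\<^bsub>translation_quandle\<^esub> z)"
    "x \<triangleleft>\<inverse>\<^bsub>translation_quandle\<^esub> y \<triangleleft>\<inverse>\<^bsub>translation_quandle\<^esub> z =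
      x \<triangleleft>\<inverse>\<^bsub>translation_quandle\<^esub> z \<triangleleft>\<inverse>\<^bsub>translation_quandle\<^esub> (y \<triangleleft>\<inverse>\<^bsub>translation_quandle\<^esub> z)"
    using act_distrib[of x] act_distrib[of x "winv _"] by (cases y; cases z; simp)+
qed

lemma countable_translation_quandle:
  "countable (carrier (translation_quandle :: (('a :: countable \<times> bool) list + _) quandle))"
  by simp

text \<open>Indices outside \<open>A\<close> take values in the right copy and act trivially, so
  \<open>filter\<close> deletes their letters. The set \<open>A\<close> is a parameter because
  variable 0 is later sent to either copy.\<close>

lemma word_act_translation_quandle:
  assumes "\<And>i. i \<in> A \<Longrightarrow> b i = Inl [(i, True)]" "\<And>i. i \<notin> A \<Longrightarrow> \<not> isl (b i)"
  shows "word_act translation_quandle b (Inr (reduce p)) w = Inr (reduce (p @ filter (\<lambda>l. fst l \<in> A) w))"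
    and "word_act translation_quandle b (Inl (reduce p)) w =
      Inl (reduce (winv (filter (\<lambda>l. fst l \<in> A) w) @ p @ filter (\<lambda>l. fst l \<in> A) w))"
proof -
  have "word_act translation_quandle b x ((i, e) # w) =
      word_act translation_quandle b (if i \<in> A then act x [(i, e)] else x) w" for x i e w
    using assms[of i] by (cases "b i") auto
  note [simp del] = word_act.simps(2) and [simp] = this
  show "word_act translation_quandle b (Inr (reduce p)) w = Inr (reduce (p @ filter (\<lambda>l. fst l \<in> A) w))"
  proof (induction w arbitrary: p)
    case (Cons l w)
    then show ?case using Cons[of "p @ [l]"] by (cases l) simp
  qed simp
  show "word_act translation_quandle b (Inl (reduce p)) w =
      Inl (reduce (winv (filter (\<lambda>l. fst l \<in> A) w) @ p @ filter (\<lambda>l. fst l \<in> A) w))"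
  proof (induction w arbitrary: p)
    case (Cons l w)
    have "reduce (winv [l] @ reduce p @ [l]) = reduce (winv [l] @ p @ [l])"
      by (simp only: reduce_reduce_middle)
    then show ?case using Cons[of p] Cons[of "flip l # p @ [l]"] by (cases l) simp
  qed simp
qed

section \<open>Free quandles: maps to countable quandles, and generation by words\<close>

section \<open>Free quandles\<close>

lemma free_quandleD:
  assumes "free_quandle n y F"
  shows "quandle F" "y \<in> {1..n} \<rightarrow> carrier F"
  using assms by (simp_all add: free_quandle_def)

lemma free_quandle_ex1:
  fixes F R :: "'u quandle"
  shows "\<lbrakk>free_quandle n y F; quandle R; c \<in> {1..n} \<rightarrow> carrier R\<rbrakk> \<Longrightarrow>
    \<exists>!h. h \<in> quandle_hom F R \<and> (\<forall>i\<in>{1..n}. h (y i) = c i)"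
  by (simp add: free_quandle_def)

lemma free_quandle_unique:
  fixes F R :: "'u quandle"
  assumes "free_quandle n y F" "quandle R" "f \<in> quandle_hom F R" "g \<in> quandle_hom F R"
    and "\<And>i. i \<in> {1..n} \<Longrightarrow> f (y i) = g (y i)"
  shows "f = g"
proof -
  have "(\<lambda>i. f (y i)) \<in> {1..n} \<rightarrow> carrier R"
    using quandle_homD(2)[OF assms(3)] free_quandleD[OF assms(1)] by auto
  from free_quandle_ex1[OF assms(1,2) this] show ?thesis using assms by auto
qed

text \<open>Extends the universal property to countable quandles of any type, at the price of
  landing in a copy \<open>R'\<close> from which \<open>g\<close> recovers the original.\<close>

lemma free_quandle_copy_hom:
  fixes F :: "'u quandle" and R :: "('b, 'm) quandle_scheme"
  assumes "infinite (UNIV :: 'u set)" "free_quandle n y F"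
    and "quandle R" "countable (carrier R)" "c \<in> {1..n} \<rightarrow> carrier R"
  obtains R' :: "'u quandle" and f g h where "quandle R'"
    "f \<in> quandle_hom R R'" "g \<in> quandle_hom R' R" "\<forall>x\<in>carrier R. g (f x) = x"
    "h \<in> quandle_hom F R'" "\<forall>i\<in>{1..n}. h (y i) = f (c i)"
proof -
  obtain R' :: "'u quandle" and f g where R': "quandle R'"
    "f \<in> quandle_hom R R'" "g \<in> quandle_hom R' R" "\<forall>x\<in>carrier R. g (f x) = x"
    by (rule quandle_copy[OF assms(1,3,4)]) (rule that, auto)
  have "(\<lambda>i. f (c i)) \<in> {1..n} \<rightarrow> carrier R'"
    using quandle_homD(2)[OF R'(2)] assms(5) by auto
  then obtain h where "h \<in> quandle_hom F R'" "\<forall>i\<in>{1..n}. h (y i) = f (c i)"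
    using free_quandle_ex1[OF assms(2) R'(1)] by blast
  with R' that show ?thesis by blast
qed

text \<open>\<open>F\<close> is a retract of the term quandle, so each of its elements is the value
  of a term at the valuation \<open>y\<close>.\<close>

lemma free_quandle_generated:
  fixes F :: "'u quandle"
  assumes "infinite (UNIV :: 'u set)" and F: "free_quandle n y F" and "x \<in> carrier F"
  obtains i w where "i \<in> {1..n}" "fst ` set w \<subseteq> {1..n}" "x = word_act F y (y i) w"
proof -
  let ?T = "term_quandle {1..n} :: ('u quandle \<times> (nat \<Rightarrow> 'u) \<Rightarrow> 'u) quandle"
  have x: "(\<lambda>i. term_value {1..n} i []) \<in> {1..n} \<rightarrow> carrier ?T"
    by (auto intro: term_value_carrier)
  obtain R' :: "'u quandle" and f g h where R': "quandle R'"
    "f \<in> quandle_hom ?T R'" "g \<in> quandle_hom R' ?T" "\<forall>x\<in>carrier ?T. g (f x) = x"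
    "h \<in> quandle_hom F R'" "\<forall>i\<in>{1..n}. h (y i) = f (term_value {1..n} i [])"
    by (rule free_quandle_copy_hom[OF assms(1) F quandle_term_quandle countable_term_quandle x]) (rule that)
  note qF = free_quandleD[OF F]
  let ?e = "\<lambda>u\<in>carrier ?T. u (F, y)"
  have e: "?e \<in> quandle_hom ?T F" by (rule term_value_hom[OF qF])
  let ?k = "compose (carrier F) ?e (compose (carrier F) g h)"
  have k: "?k \<in> quandle_hom F F" using R' e qF by (intro compose_hom)
  \<comment> \<open>The round trip through the term quandle fixes every \<open>y i\<close>, so it is
    the identity by uniqueness.\<close>
  have "?k = (\<lambda>x\<in>carrier F. x)"
  proof (rule free_quandle_unique[OF F qF(1) k id_hom[OF qF(1)]])
    fix i assume i: "i \<in> {1..n}"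
    with qF have "y i \<in> carrier F" by auto
    moreover have "term_value {1..n} i [] \<in> carrier ?T" using i by (auto intro: term_value_carrier)
    moreover have "term_value {1..n} i [] (F, y) = y i" by (subst term_value_eq[OF qF]) simp
    ultimately show "?k (y i) = (\<lambda>x\<in>carrier F. x) (y i)"
      using R'(4,6) i by (simp add: compose_eq)
  qed
  then have "?k x = x" using assms(3) by simp
  moreover have mem: "g (h x) \<in> carrier ?T"
    using assms(3) R' by (blast intro: quandle_homD(2))
  ultimately have "x = g (h x) (F, y)" using assms(3) by (simp add: compose_eq)
  moreover from mem obtain i w where "i \<in> {1..n}" "fst ` set w \<subseteq> {1..n}" "g (h x) = term_value {1..n} i w"
    by (rule term_quandleE)
  ultimately show thesis using that term_value_eq[OF qF] by metis
qed

section \<open>Natural automorphisms under a free quandle\<close>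

section \<open>The isotropy group of a free quandle\<close>

lemma quandles_underD: "(Q, h) \<in> quandles_under M \<Longrightarrow> quandle Q" "(Q, h) \<in> quandles_under M \<Longrightarrow> h \<in> quandle_hom M Q"
  by (auto simp: quandles_under_def)

lemma quandles_underI: "\<lbrakk>quandle Q; h \<in> quandle_hom M Q\<rbrakk> \<Longrightarrow> (Q, h) \<in> quandles_under M"
  by (auto simp: quandles_under_def)

lemma isotropy_groupD:
  assumes "\<pi> \<in> carrier (isotropy_group M)" "(Q, h) \<in> quandles_under M"
  shows "\<pi> (Q, h) \<in> carrier (quandle_aut Q)"
    and "\<lbrakk>quandle R; k \<in> quandle_hom Q R; q \<in> carrier Q\<rbrakk> \<Longrightarrow>
      k (\<pi> (Q, h) q) = \<pi> (R, compose (carrier M) k h) (k q)"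
proof -
  show "\<pi> (Q, h) \<in> carrier (quandle_aut Q)"
    using assms by (auto simp: isotropy_group_def PiE_iff)
  assume "quandle R" "k \<in> quandle_hom Q R" and q: "q \<in> carrier Q"
  then have "compose (carrier Q) k (\<pi> (Q, h)) = compose (carrier Q) (\<pi> (R, compose (carrier M) k h)) k"
    using assms by (auto simp: isotropy_group_def)
  from fun_cong[OF this, of q] q show "k (\<pi> (Q, h) q) = \<pi> (R, compose (carrier M) k h) (k q)"
    by (simp add: compose_eq)
qed

lemma quandle_autD:
  assumes "f \<in> carrier (quandle_aut Q)"
  shows "f \<in> quandle_hom Q Q" "bij_betw f (carrier Q) (carrier Q)"
  using assms by (auto simp: quandle_aut_def)

text \<open>A word acts by automorphisms, and naturality holds because morphisms commute with the
  action of words.\<close>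

lemma word_in_isotropy_group:
  assumes M: "quandle M" and b: "b \<in> fst ` set w \<rightarrow> carrier M" and \<pi>: "\<pi> \<in> extensional (quandles_under M)"
    and eq: "\<And>Q h. (Q, h) \<in> quandles_under M \<Longrightarrow>
      \<pi> (Q, h) = (\<lambda>q\<in>carrier Q. word_act Q (\<lambda>i. h (b i)) q w)"
  shows "\<pi> \<in> carrier (isotropy_group M)"
proof -
  have hb: "(\<lambda>i. h (b i)) \<in> fst ` set w \<rightarrow> carrier Q" if "(Q, h) \<in> quandles_under M" for Q h
    using b quandle_homD(2)[OF quandles_underD(2)[OF that]] by auto
  have aut: "\<pi> (Q, h) \<in> carrier (quandle_aut Q)" if "(Q, h) \<in> quandles_under M" for Q h
    unfolding eq[OF that] by (rule quandle.word_act_aut[OF quandles_underD(1)[OF that] hb[OF that]])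
  have "compose (carrier Q) k (\<pi> (Q, h)) = compose (carrier Q) (\<pi> (R, compose (carrier M) k h)) k"
    if Qh: "(Q, h) \<in> quandles_under M" and R: "quandle R" and k: "k \<in> quandle_hom Q R" for Q h R k
  proof (unfold compose_def[of "carrier Q"], rule restrict_ext)
    fix q assume q: "q \<in> carrier Q"
    have kh: "(R, compose (carrier M) k h) \<in> quandles_under M"
      using Qh R k M by (blast intro: quandles_underI compose_hom dest: quandles_underD)
    have "k (\<pi> (Q, h) q) = word_act R (\<lambda>i. k (h (b i))) (k q) w"
      using quandle.word_act_hom[OF quandles_underD(1)[OF Qh] k q hb[OF Qh]] q by (simp add: eq[OF Qh])
    also have "\<dots> = word_act R (\<lambda>i. compose (carrier M) k h (b i)) (k q) w"
      by (intro word_act_cong) (simp add: compose_eq[OF funcset_mem[OF b]])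
    also have "\<dots> = \<pi> (R, compose (carrier M) k h) (k q)"
      using quandle_homD(2)[OF k q] by (simp add: eq[OF kh])
    finally show "k (\<pi> (Q, h) q) = \<pi> (R, compose (carrier M) k h) (k q)" .
  qed
  with aut \<pi> show ?thesis
    by (auto simp: isotropy_group_def PiE_iff quandles_under_def)
qed

definition letter :: "'a \<Rightarrow> ('a \<times> bool) list + ('a \<times> bool) list"
  where "letter i = Inl [(i, True)]"

lemma reduce_singleton [simp]: "reduce [l] = [l]"
  by (simp add: reduce_reduced)

lemma letter_closed: "letter i \<in> carrier translation_quandle"
  by (simp add: letter_def carrier_translation_quandle)

context
  fixes n :: nat and y :: "nat \<Rightarrow> 'u" and F :: "'u quandle"
  assumes universe: "infinite (UNIV :: 'u set)" and free: "free_quandle n y F"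
begin

lemma quandle_F: "quandle F" and y_closed: "i \<in> {1..n} \<Longrightarrow> y i \<in> carrier F"
  using free_quandleD[OF free] by auto

text \<open>Injectivity of \<open>f\<close> allows equations proved in the copy inside
  \<open>'u\<close> to be pulled back to the free group.\<close>

lemma translation_hom:
  obtains R' :: "'u quandle" and f h where "quandle R'"
    "f \<in> quandle_hom translation_quandle R'" "inj_on f (carrier translation_quandle)"
    "h \<in> quandle_hom F R'" "\<forall>i\<in>{1..n}. h (y i) = f (letter i)"
proof -
  have "letter \<in> {1..n} \<rightarrow> carrier translation_quandle" by (simp add: letter_closed)
  from free_quandle_copy_hom[OF universe free quandle_translation_quandle
      countable_translation_quandle this]
  show thesis by (metis that inj_on_inverseI)
qed

text \<open>The variable \<open>0\<close> stands for the generic element.\<close>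

lemma isotropy_term:
  assumes \<pi>: "\<pi> \<in> carrier (isotropy_group F)"
  obtains j w where "j \<in> {0..n}" "fst ` set w \<subseteq> {0..n}"
    "\<And>Q h q. \<lbrakk>(Q, h) \<in> quandles_under F; q \<in> carrier Q\<rbrakk> \<Longrightarrow>
      \<pi> (Q, h) q = word_act Q ((\<lambda>i. h (y i))(0 := q)) (((\<lambda>i. h (y i))(0 := q)) j) w"
proof -
  let ?T = "term_quandle {0..n} :: ('u quandle \<times> (nat \<Rightarrow> 'u) \<Rightarrow> 'u) quandle"
  let ?x = "\<lambda>i. term_value {0..n} i []"
  have x: "?x i \<in> carrier ?T" if "i \<in> {0..n}" for i
    using that by (auto intro: term_value_carrier)
  then have x': "?x \<in> {1..n} \<rightarrow> carrier ?T" by auto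
  obtain R' :: "'u quandle" and f g h0 where R': "quandle R'"
    "f \<in> quandle_hom ?T R'" "g \<in> quandle_hom R' ?T" "\<forall>x\<in>carrier ?T. g (f x) = x"
    "h0 \<in> quandle_hom F R'" "\<forall>i\<in>{1..n}. h0 (y i) = f (?x i)"
    by (rule free_quandle_copy_hom[OF universe free quandle_term_quandle countable_term_quandle x']) (rule that)
  have fx: "f (?x 0) \<in> carrier R'" by (rule quandle_homD(2)[OF R'(2) x]) simp
  have R'h0: "(R', h0) \<in> quandles_under F" using R' by (intro quandles_underI)
  \<comment> \<open>The value of \<open>\<pi>\<close> at the generic element is read back as a term
    \<open>(j, w)\<close>, the one to be used for every object and element.\<close>
  have "g (\<pi> (R', h0) (f (?x 0))) \<in> carrier ?T"
    using quandle_homD(2)[OF quandle_autD(1)[OF isotropy_groupD(1)[OF \<pi> R'h0]] fx] quandle_homD(2)[OF R'(3)]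
    by blast
  then obtain j w where w: "j \<in> {0..n}" "fst ` set w \<subseteq> {0..n}"
    "g (\<pi> (R', h0) (f (?x 0))) = term_value {0..n} j w"
    by (rule term_quandleE)
  show thesis
  proof (rule that[OF w(1,2)])
    fix Q h q assume Qh: "(Q, h) \<in> quandles_under F" and q: "q \<in> carrier Q"
    note Q = quandles_underD[OF Qh]
    define b where "b = (\<lambda>i. h (y i))(0 := q)"
    have b: "b \<in> {0..n} \<rightarrow> carrier Q"
      using q quandle_homD(2)[OF Q(2)] y_closed by (auto simp: b_def)
    let ?e = "\<lambda>u\<in>carrier ?T. u (Q, b)"
    \<comment> \<open>Specialization: \<open>?p\<close> sends the generic element to
      \<open>q\<close> and the generators to \<open>h (y i)\<close>, so naturality along
      \<open>?p\<close> carries the term to its value in \<open>Q\<close>.\<close>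
    let ?p = "compose (carrier R') ?e g"
    have p: "?p \<in> quandle_hom R' Q"
      using R' term_value_hom[OF Q(1) b] by (intro compose_hom)
    have px: "?p (f (?x i)) = b i" if "i \<in> {0..n}" for i
      using x[OF that] quandle_homD(2)[OF R'(2)] R'(4) by (simp add: compose_eq term_value_eq[OF Q(1) b])
    have "compose (carrier F) ?p h0 = h"
    proof (rule free_quandle_unique[OF free Q(1) compose_hom[OF quandle_F R'(5) p] Q(2)])
      fix i assume i: "i \<in> {1..n}"
      then show "compose (carrier F) ?p h0 (y i) = h (y i)"
        using px[of i] by (simp add: compose_eq[of "y i"] y_closed R'(6) b_def)
    qed
    then have "?p (\<pi> (R', h0) (f (?x 0))) = \<pi> (Q, h) q"
      using isotropy_groupD(2)[OF \<pi> R'h0 Q(1) p fx] px[of 0] by (simp add: b_def)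
    moreover have "?p (\<pi> (R', h0) (f (?x 0))) = word_act Q b (b j) w"
      using quandle_homD(2)[OF quandle_autD(1)[OF isotropy_groupD(1)[OF \<pi> R'h0]] fx] w
        term_value_carrier[OF w(1,2), where ?'a = 'u]
      by (simp add: compose_eq term_value_eq[OF Q(1) b])
    ultimately show "\<pi> (Q, h) q = word_act Q ((\<lambda>i. h (y i))(0 := q)) (((\<lambda>i. h (y i))(0 := q)) j) w"
      by (simp add: b_def)
  qed
qed

lemma isotropy_word:
  assumes \<pi>: "\<pi> \<in> carrier (isotropy_group F)"
  obtains w where "w \<in> reduced_words n"
    "\<And>Q h q. \<lbrakk>(Q, h) \<in> quandles_under F; q \<in> carrier Q\<rbrakk> \<Longrightarrow>
      \<pi> (Q, h) q = word_act Q (\<lambda>i. h (y i)) q w"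
proof -
  obtain j w where j: "j \<in> {0..n}" and w: "fst ` set w \<subseteq> {0..n}"
    and eq: "\<And>Q h q. \<lbrakk>(Q, h) \<in> quandles_under F; q \<in> carrier Q\<rbrakk> \<Longrightarrow>
      \<pi> (Q, h) q = word_act Q ((\<lambda>i. h (y i))(0 := q)) (((\<lambda>i. h (y i))(0 := q)) j) w"
    using isotropy_term[OF \<pi>] by blast
  have "j = 0"
  proof (rule ccontr)
    \<comment> \<open>In a trivial quandle all words act as the identity, so \<open>\<pi>\<close>
      would have the constant value \<open>h (y j) = c\<close>, against injectivity.\<close>
    assume "j \<noteq> 0"
    define Q :: "'u quandle" where "Q = \<lparr>carrier = UNIV, qop = \<lambda>x y. x, qinv = \<lambda>x y. x\<rparr>"
    have Q: "quandle Q" by unfold_locales (simp_all add: Q_def)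
    have carrier_Q: "carrier Q = UNIV" by (simp add: Q_def)
    have act: "word_act Q b q v = q" for b q v
      by (induction v) (auto simp: Q_def)
    obtain c d :: 'u where "c \<noteq> d" using universe by (metis finite.simps UNIV_I ex_new_if_finite insertCI)
    have "(\<lambda>x\<in>carrier F. c) \<in> quandle_hom F Q"
      by (rule quandle_homI) (auto simp: Q_def quandle_F)
    then have Qh: "(Q, \<lambda>x\<in>carrier F. c) \<in> quandles_under F" by (rule quandles_underI[OF Q])
    have "\<pi> (Q, \<lambda>x\<in>carrier F. c) q = c" for q
      using eq[OF Qh, of q] \<open>j \<noteq> 0\<close> j y_closed[of j] by (simp add: act carrier_Q)
    moreover have "inj_on (\<pi> (Q, \<lambda>x\<in>carrier F. c)) UNIV"
      using quandle_autD(2)[OF isotropy_groupD(1)[OF \<pi> Qh]] by (simp add: Q_def bij_betw_def)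
    ultimately show False using \<open>c \<noteq> d\<close> by (auto simp: inj_on_def)
  qed
  let ?T = "translation_quandle :: ((nat \<times> bool) list + (nat \<times> bool) list) quandle"
  obtain R' :: "'u quandle" and f h where R': "quandle R'" "f \<in> quandle_hom ?T R'" "inj_on f (carrier ?T)"
    "h \<in> quandle_hom F R'" "\<forall>i\<in>{1..n}. h (y i) = f (letter i)"
    by (rule translation_hom) (rule that)
  have R'h: "(R', h) \<in> quandles_under F" using R' by (intro quandles_underI)
  \<comment> \<open>The component of \<open>\<pi>\<close> at the copy, pulled back along
    \<open>f\<close>, is the term operation of \<open>w\<close> on the test quandle.\<close>
  have T: "f (word_act ?T (letter(0 := x)) x w) = \<pi> (R', h) (f x)" if x: "x \<in> carrier ?T" for x
  proof -
    have "f (word_act ?T (letter(0 := x)) x w) = word_act R' (\<lambda>i. f ((letter(0 := x)) i)) (f x) w"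
      using x letter_closed by (intro quandle.word_act_hom[OF quandle_translation_quandle R'(2)]) auto
    also have "\<dots> = word_act R' ((\<lambda>i. h (y i))(0 := f x)) (f x) w"
      using w R'(5) by (intro word_act_cong) (fastforce simp: Suc_le_eq)
    also have "\<dots> = \<pi> (R', h) (f x)"
      using eq[OF R'h quandle_homD(2)[OF R'(2) x]] \<open>j = 0\<close> by simp
    finally show ?thesis .
  qed
  define t where "t x = word_act ?T (letter(0 := x)) x w" for x
  have t: "t x \<in> carrier ?T" if "x \<in> carrier ?T" for x
    unfolding t_def using that letter_closed by (intro quandle.word_act_closed[OF quandle_translation_quandle]) auto
  have t_hom: "t (x \<triangleleft>\<^bsub>?T\<^esub> z) = t x \<triangleleft>\<^bsub>?T\<^esub> t z" if x: "x \<in> carrier ?T" and z: "z \<in> carrier ?T" for x z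
  proof -
    have xz: "x \<triangleleft>\<^bsub>?T\<^esub> z \<in> carrier ?T"
      using x z by (rule quandle.qop_closed[OF quandle_translation_quandle])
    note hom\<pi> = quandle_autD(1)[OF isotropy_groupD(1)[OF \<pi> R'h]]
    have "f (t (x \<triangleleft>\<^bsub>?T\<^esub> z)) = f (t x \<triangleleft>\<^bsub>?T\<^esub> t z)"
      using T[OF x] T[OF z] T[OF xz]
      by (simp add: t_def[symmetric] quandle_homD[OF R'(2)] quandle_homD[OF hom\<pi>] x z t)
    then show ?thesis
      by (rule inj_onD[OF R'(3)]) (intro t xz quandle.qop_closed[OF quandle_translation_quandle] x z)+
  qed
  define v where "v = filter (\<lambda>l. fst l \<noteq> 0) w"
  \<comment> \<open>With \<open>Inr p\<close> as variable 0, the letters of index 0 act trivially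
    and only those in \<open>v\<close> remain.\<close>
  have tr: "t (Inr p) = Inr (reduce (p @ v))" if "reduce p = p" for p
    using word_act_translation_quandle(1)[of "-{0}" "letter(0 := Inr p)" p w] that
    by (simp add: t_def v_def letter_def)
  \<comment> \<open>Giving variable 0 the free generator 0 as its value makes the valuation
    \<open>letter\<close>, which retains all of \<open>w\<close>.\<close>
  have tl: "t (Inl [(0, True)]) = Inl (reduce (winv w @ (0, True) # w))"
    using word_act_translation_quandle(2)[of UNIV letter "[(0, True)]" w]
    by (simp add: t_def letter_def fun_upd_idem)
  have "t (Inr [] \<triangleleft>\<^bsub>?T\<^esub> Inl [(0, True)]) = t (Inr []) \<triangleleft>\<^bsub>?T\<^esub> t (Inl [(0, True)])"
    by (rule t_hom) (simp_all add: carrier_translation_quandle)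
  then have "reduce ((0, True) # v) = reduce (v @ winv w @ (0, True) # w)"
    by (simp add: tr tl)
  \<comment> \<open>Multiplication by \<open>winv v\<close> on the left turns the equation into an
    equality of two conjugates of letter 0.\<close>
  from reduce_cong_append[OF this, of "winv v"]
  have "reduce (winv v @ (0, True) # v) = reduce (winv w @ (0, True) # w)" by simp
  moreover have "reduce (winv (reduce u) @ (0, True) # reduce u) = reduce (winv u @ (0, True) # u)"
    for u :: "(nat \<times> bool) list"
    using reduce_reduce_right[of "winv u @ [(0, True)]" u] by simp
  ultimately have "strip 0 (reduce v) = strip 0 (reduce w)"
    by (intro conj_eq_strip[where e = True]) simp_all
  \<comment> \<open>No letter of \<open>v\<close> has index 0, so stripping does not affect its
    reduced form.\<close>
  moreover have "fst l \<noteq> 0" if "l \<in> set (reduce v)" for l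
    using set_reduce[of v] that by (auto simp: v_def)
  then have "strip 0 (reduce v) = reduce v" by (cases "reduce v") auto
  ultimately have vw: "reduce v = strip 0 (reduce w)" by simp
  have v: "fst ` set (reduce v) \<subseteq> {1..n}"
    using set_reduce[of v] w by (fastforce simp: v_def Suc_le_eq)
  show thesis
  proof (rule that)
    show "reduce v \<in> reduced_words n" using v by (simp add: reduced_words_eq)
    fix Q h q assume Qh: "(Q, h) \<in> quandles_under F" and q: "q \<in> carrier Q"
    interpret quandle Q by (rule quandles_underD[OF Qh])
    let ?b = "(\<lambda>i. h (y i))(0 := q)"
    have "i \<in> {0..n} \<Longrightarrow> ?b i \<in> carrier Q" for i
      using q quandle_homD(2)[OF quandles_underD(2)[OF Qh]] y_closed by auto
    then have b: "?b \<in> fst ` set w \<rightarrow> carrier Q" using w by blast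
    have "\<pi> (Q, h) q = word_act Q ?b q w" using eq[OF Qh q] \<open>j = 0\<close> by simp
    \<comment> \<open>\<open>reduce w\<close> differs from \<open>reduce v\<close> only by leading
      letters of index 0, which fix \<open>q = ?b 0\<close>.\<close>
    also have "\<dots> = word_act Q ?b q (reduce v)"
      using word_act_reduce[OF q b] word_act_strip[of ?b 0 "reduce w"] q by (simp add: vw)
    also have "\<dots> = word_act Q (\<lambda>i. h (y i)) q (reduce v)"
      using v by (intro word_act_cong) auto
    finally show "\<pi> (Q, h) q = word_act Q (\<lambda>i. h (y i)) q (reduce v)" .
  qed
qed

text \<open>Right translation is a free action: applied to \<open>Inr []\<close>, a reduced word
  returns itself.\<close>

lemma family_word_unique:
  assumes v: "v \<in> reduced_words n" and w: "w \<in> reduced_words n"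
    and eq: "\<And>Q h q. \<lbrakk>(Q, h) \<in> quandles_under F; q \<in> carrier Q\<rbrakk> \<Longrightarrow>
      word_act Q (\<lambda>i. h (y i)) q v = word_act Q (\<lambda>i. h (y i)) q w"
  shows "v = w"
proof -
  let ?T = "translation_quandle :: ((nat \<times> bool) list + (nat \<times> bool) list) quandle"
  obtain R' :: "'u quandle" and f h where R': "quandle R'" "f \<in> quandle_hom ?T R'" "inj_on f (carrier ?T)"
    "h \<in> quandle_hom F R'" "\<forall>i\<in>{1..n}. h (y i) = f (letter i)"
    by (rule translation_hom) (rule that)
  have q: "Inr [] \<in> carrier ?T" by (simp add: carrier_translation_quandle)
  have "word_act R' (\<lambda>i. h (y i)) (f (Inr [])) u = f (Inr u)" if u: "u \<in> reduced_words n" for u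
  proof -
    have "word_act R' (\<lambda>i. h (y i)) (f (Inr [])) u = word_act R' (\<lambda>i. f (letter i)) (f (Inr [])) u"
      using u R'(5) by (intro word_act_cong) (auto simp: reduced_words_eq)
    also have "\<dots> = f (word_act ?T letter (Inr []) u)"
      using letter_closed q by (intro quandle.word_act_hom[OF quandle_translation_quandle R'(2), symmetric]) auto
    also have "word_act ?T letter (Inr []) u = Inr u"
      using word_act_translation_quandle(1)[of UNIV letter "[]" u] u
      by (simp add: letter_def reduced_words_eq reduce_reduced)
    finally show ?thesis .
  qed
  with v w eq[OF quandles_underI[OF R'(1,4)] quandle_homD(2)[OF R'(2) q]]
  have "f (Inr v) = f (Inr w)" by simp
  moreover have "Inr v \<in> carrier ?T" "Inr w \<in> carrier ?T"
    using v w by (simp_all add: carrier_translation_quandle reduced_words_eq reduce_reduced)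
  ultimately have "Inr v = (Inr w :: (nat \<times> bool) list + (nat \<times> bool) list)"
    by (rule inj_onD[OF R'(3)])
  then show ?thesis by simp
qed

text \<open>Mapping \<open>y i\<close> to letter \<open>i\<close> in the conjugation copy exposes
  the conjugate of each generator by the word. For \<open>n = 0\<close> the empty word is the only
  one; otherwise there are two generators and \<open>conj_inj\<close> applies.\<close>

lemma word_unique:
  assumes n: "n \<noteq> 1" and v: "v \<in> reduced_words n" and w: "w \<in> reduced_words n"
    and eq: "\<And>a. a \<in> carrier F \<Longrightarrow> word_act F y a v = word_act F y a w"
  shows "v = w"
proof (cases "n = 0")
  case True
  then show ?thesis using v w by (simp add: reduced_words_eq)
next
  case False
  let ?T = "translation_quandle :: ((nat \<times> bool) list + (nat \<times> bool) list) quandle"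
  obtain R' :: "'u quandle" and f h where R': "quandle R'" "f \<in> quandle_hom ?T R'" "inj_on f (carrier ?T)"
    "h \<in> quandle_hom F R'" "\<forall>i\<in>{1..n}. h (y i) = f (letter i)"
    by (rule translation_hom) (rule that)
  have *: "h (word_act F y (y i) u) = f (Inl (reduce (winv u @ (i, True) # u)))"
    if u: "u \<in> reduced_words n" and i: "i \<in> {1..n}" for u i
  proof -
    have "h (word_act F y (y i) u) = word_act R' (\<lambda>i. h (y i)) (h (y i)) u"
      using u i y_closed by (intro quandle.word_act_hom[OF quandle_F R'(4)]) (auto simp: reduced_words_eq)
    also have "\<dots> = word_act R' (\<lambda>i. f (letter i)) (f (letter i)) u"
      using u i R'(5) by (auto simp: reduced_words_eq intro!: word_act_cong)
    also have "\<dots> = f (word_act ?T letter (letter i) u)"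
      using letter_closed by (intro quandle.word_act_hom[OF quandle_translation_quandle R'(2), symmetric]) auto
    also have "word_act ?T letter (letter i) u = Inl (reduce (winv u @ (i, True) # u))"
      using word_act_translation_quandle(2)[of UNIV letter "[(i, True)]" u]
      by (simp add: letter_def reduce_reduced)
    finally show ?thesis .
  qed
  have conj: "reduce (winv v @ (i, True) # v) = reduce (winv w @ (i, True) # w)" if i: "i \<in> {1..n}" for i
  proof -
    have "f (Inl (reduce (winv v @ (i, True) # v))) = f (Inl (reduce (winv w @ (i, True) # w)))"
      using *[OF v i] *[OF w i] eq[OF y_closed[OF i]] by simp
    then have "(Inl (reduce (winv v @ (i, True) # v)) :: (nat \<times> bool) list + (nat \<times> bool) list) =
        Inl (reduce (winv w @ (i, True) # w))"
      by (rule inj_onD[OF R'(3)]) (simp_all add: carrier_translation_quandle)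
    then show ?thesis by simp
  qed
  have "1 \<in> {1..n}" "2 \<in> {1..n}" using n False by auto
  from conj_inj[OF _ _ _ this[THEN conj]] v w show ?thesis by (simp add: reduced_words_eq)
qed

text \<open>Forwards, the word of a natural automorphism is read at the identity morphism;
  backwards, the word defines a whole natural family.\<close>

lemma categorical_inner_iff:
  assumes h: "h \<in> quandle_hom F F"
  shows "h \<in> categorical_inner F \<longleftrightarrow>
    (\<exists>w. w \<in> reduced_words n \<and> (\<forall>a\<in>carrier F. h a = word_act F y a w))"
proof
  have id: "(F, \<lambda>x\<in>carrier F. x) \<in> quandles_under F"
    by (rule quandles_underI[OF quandle_F id_hom[OF quandle_F]])
  have id_eq: "word_act F (\<lambda>i. (\<lambda>x\<in>carrier F. x) (y i)) a w = word_act F y a w"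
    if "w \<in> reduced_words n" for a w
    using that y_closed by (intro word_act_cong) (auto simp: reduced_words_eq)
  {
    assume "h \<in> categorical_inner F"
    then obtain \<pi> where \<pi>: "\<pi> \<in> carrier (isotropy_group F)" "h = \<pi> (F, \<lambda>x\<in>carrier F. x)"
      by (auto simp: categorical_inner_def)
    from isotropy_word[OF \<pi>(1)] obtain w where "w \<in> reduced_words n"
      "\<And>Q h q. \<lbrakk>(Q, h) \<in> quandles_under F; q \<in> carrier Q\<rbrakk> \<Longrightarrow>
        \<pi> (Q, h) q = word_act Q (\<lambda>i. h (y i)) q w" by blast
    with id id_eq \<pi>(2) show "\<exists>w. w \<in> reduced_words n \<and> (\<forall>a\<in>carrier F. h a = word_act F y a w)"
      by auto
  next
    assume "\<exists>w. w \<in> reduced_words n \<and> (\<forall>a\<in>carrier F. h a = word_act F y a w)"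
    then obtain w where w: "w \<in> reduced_words n" "\<And>a. a \<in> carrier F \<Longrightarrow> h a = word_act F y a w"
      by blast
    have yw: "y \<in> fst ` set w \<rightarrow> carrier F" using w(1) y_closed by (auto simp: reduced_words_eq)
    define \<pi> where "\<pi> = (\<lambda>(Q, k)\<in>quandles_under F. \<lambda>q\<in>carrier Q. word_act Q (\<lambda>i. k (y i)) q w)"
    have "\<pi> \<in> carrier (isotropy_group F)"
      by (rule word_in_isotropy_group[OF quandle_F yw]) (simp_all add: \<pi>_def)
    moreover have "h = (\<lambda>a\<in>carrier F. word_act F y a w)"
      using quandle_homD(1)[OF h] w(2) by (intro extensionalityI) auto
    then have "h \<in> carrier (quandle_aut F)" "h = \<pi> (F, \<lambda>x\<in>carrier F. x)"
      using quandle.word_act_aut[OF quandle_F yw] id id_eq[OF w(1)] by (simp_all add: \<pi>_def)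
    ultimately show "h \<in> categorical_inner F" unfolding categorical_inner_def by blast
  }
qed

end

section \<open>The group generated by right multiplications, described by words\<close>

section \<open>Algebraic inner automorphisms\<close>

context quandle
begin

lemma group_quandle_aut: "group (quandle_aut Q)"
proof (rule groupI)
  show "f \<otimes>\<^bsub>quandle_aut Q\<^esub> g \<in> carrier (quandle_aut Q)"
    if "f \<in> carrier (quandle_aut Q)" "g \<in> carrier (quandle_aut Q)" for f g
    using that compose_hom[OF quandle_axioms, of g Q f Q] bij_betw_compose[of g _ _ f]
    by (auto simp: quandle_aut_def)
  show "\<one>\<^bsub>quandle_aut Q\<^esub> \<in> carrier (quandle_aut Q)"
    using id_hom[OF quandle_axioms] by (auto simp: quandle_aut_def bij_betw_def inj_on_def)
  show "f \<otimes>\<^bsub>quandle_aut Q\<^esub> g \<otimes>\<^bsub>quandle_aut Q\<^esub> k = f \<otimes>\<^bsub>quandle_aut Q\<^esub> (g \<otimes>\<^bsub>quandle_aut Q\<^esub> k)"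
    if "f \<in> carrier (quandle_aut Q)" "g \<in> carrier (quandle_aut Q)" "k \<in> carrier (quandle_aut Q)" for f g k
    using that by (auto simp: quandle_aut_def compose_def fun_eq_iff quandle_homD)
  fix f assume f: "f \<in> carrier (quandle_aut Q)"
  then have hom: "f \<in> quandle_hom Q Q" and bij: "bij_betw f (carrier Q) (carrier Q)"
    by (simp_all add: quandle_aut_def)
  show "\<one>\<^bsub>quandle_aut Q\<^esub> \<otimes>\<^bsub>quandle_aut Q\<^esub> f = f"
    using quandle_homD[OF hom] by (auto simp: quandle_aut_def compose_def intro!: extensionalityI[of _ "carrier Q"])
  let ?g = "inv_into (carrier Q) f"
  have g: "?g x \<in> carrier Q" "f (?g x) = x" if "x \<in> carrier Q" for x
    using bij that by (auto simp: bij_betw_def f_inv_into_f intro: inv_into_into)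
  have gf: "?g (f x) = x" if "x \<in> carrier Q" for x
    using bij that by (simp add: bij_betw_def)
  have "restrict ?g (carrier Q) \<in> quandle_hom Q Q"
  proof (rule quandle_homI)
    fix a b assume a: "a \<in> carrier Q" "b \<in> carrier Q"
    show "?g (a \<triangleleft> b) = ?g a \<triangleleft> ?g b" "?g (a \<triangleleft>\<inverse> b) = ?g a \<triangleleft>\<inverse> ?g b"
      using gf[of "?g a \<triangleleft> ?g b"] gf[of "?g a \<triangleleft>\<inverse> ?g b"] a
      by (simp_all add: quandle_homD[OF hom] g qop_closed qinv_closed)
  qed (simp_all add: g quandle_axioms)
  moreover have "bij_betw (restrict ?g (carrier Q)) (carrier Q) (carrier Q)"
    using bij_betw_inv_into[OF bij] by (simp cong: bij_betw_cong)
  moreover have "restrict ?g (carrier Q) \<otimes>\<^bsub>quandle_aut Q\<^esub> f = \<one>\<^bsub>quandle_aut Q\<^esub>"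
    using gf quandle_homD(2)[OF hom] by (auto simp: quandle_aut_def compose_def)
  ultimately show "\<exists>g\<in>carrier (quandle_aut Q). g \<otimes>\<^bsub>quandle_aut Q\<^esub> f = \<one>\<^bsub>quandle_aut Q\<^esub>"
    by (auto simp: quandle_aut_def)
qed

lemma inner_in_quandle_aut:
  assumes "r \<in> carrier Q"
  shows "(\<lambda>q\<in>carrier Q. q \<triangleleft> r) \<in> carrier (quandle_aut Q)"
    and "(\<lambda>q\<in>carrier Q. q \<triangleleft>\<inverse> r) \<in> carrier (quandle_aut Q)"
  \<comment> \<open>One-letter words; the valuation is constant, so any index will do.\<close>
  using word_act_aut[of "\<lambda>_. r" "[(undefined, True)]"]
    word_act_aut[of "\<lambda>_. r" "[(undefined, False)]"] assms by simp_all

lemma inv_inner: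
  assumes "r \<in> carrier Q"
  shows "inv\<^bsub>quandle_aut Q\<^esub> (\<lambda>q\<in>carrier Q. q \<triangleleft> r) = (\<lambda>q\<in>carrier Q. q \<triangleleft>\<inverse> r)"
  using assms inner_in_quandle_aut[OF assms]
  by (intro group.inv_equality[OF group_quandle_aut])
    (auto simp: quandle_aut_def compose_def qop_qinv qop_closed)

lemma word_act_algebraic_inner:
  assumes "b \<in> fst ` set w \<rightarrow> carrier Q"
  shows "(\<lambda>q\<in>carrier Q. word_act Q b q w) \<in> algebraic_inner Q"
  using assms
proof (induction w)
  case Nil
  have "\<one>\<^bsub>quandle_aut Q\<^esub> \<in> algebraic_inner Q" unfolding algebraic_inner_def by (rule generate.one)
  then show ?case by (simp add: quandle_aut_def restrict_def)
next
  case (Cons l w)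
  obtain i e where l: "l = (i, e)" by (cases l)
  then have b: "b i \<in> carrier Q" "b \<in> fst ` set w \<rightarrow> carrier Q" using Cons.prems by auto
  define s where "s = (\<lambda>q\<in>carrier Q. if e then q \<triangleleft> b i else q \<triangleleft>\<inverse> b i)"
  have "(\<lambda>q\<in>carrier Q. q \<triangleleft> b i) \<in> {\<lambda>q\<in>carrier Q. q \<triangleleft> r |r. r \<in> carrier Q}" using b(1) by blast
  from generate.incl[OF this, of "quandle_aut Q"] generate.inv[OF this, of "quandle_aut Q"]
  have "s \<in> algebraic_inner Q"
    by (cases e) (simp_all add: s_def algebraic_inner_def inv_inner[OF b(1)])
  \<comment> \<open>The product in \<open>quandle_aut Q\<close> applies its right factor first, so
    the first letter of the word stands on the right.\<close>
  then have "(\<lambda>q\<in>carrier Q. word_act Q b q w) \<otimes>\<^bsub>quandle_aut Q\<^esub> s \<in> algebraic_inner Q"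
    using Cons.IH[OF b(2)] unfolding algebraic_inner_def by (intro generate.eng)
  also have "(\<lambda>q\<in>carrier Q. word_act Q b q w) \<otimes>\<^bsub>quandle_aut Q\<^esub> s = (\<lambda>q\<in>carrier Q. word_act Q b q (l # w))"
    unfolding quandle_aut_def monoid.simps compose_def l s_def
    by (rule restrict_ext) (use b(1) in \<open>cases e; simp add: qop_closed qinv_closed\<close>)
  finally show ?case .
qed

end

text \<open>Each \<open>r\<close> in \<open>F\<close> is a translate of some \<open>y i\<close>, so
  \<open>qop_word_act\<close> replaces multiplication by \<open>r\<close> with a word in the
  generators; composition concatenates words.\<close>

lemma free_algebraic_inner_word:
  fixes F :: "'u quandle"
  assumes universe: "infinite (UNIV :: 'u set)" and free: "free_quandle n y F"
    and "h \<in> algebraic_inner F"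
  shows "\<exists>w. fst ` set w \<subseteq> {1..n} \<and> (\<forall>a\<in>carrier F. h a = word_act F y a w)"
  using assms(3) unfolding algebraic_inner_def
proof (induction h rule: generate.induct)
  interpret quandle F by (rule free_quandleD[OF free])
  case one
  show ?case by (intro exI[of _ "[]"]) (simp add: quandle_aut_def)
next
  interpret quandle F by (rule free_quandleD[OF free])
  have single: "\<exists>w. fst ` set w \<subseteq> {1..n} \<and> (\<forall>a\<in>carrier F. (\<lambda>q\<in>carrier F. q \<triangleleft>\<^bsub>F\<^esub> r) a = word_act F y a w)"
    "\<exists>w. fst ` set w \<subseteq> {1..n} \<and> (\<forall>a\<in>carrier F. (\<lambda>q\<in>carrier F. q \<triangleleft>\<inverse>\<^bsub>F\<^esub> r) a = word_act F y a w)"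
    if r: "r \<in> carrier F" for r
  proof -
    obtain i w where w: "i \<in> {1..n}" "fst ` set w \<subseteq> {1..n}" "r = word_act F y (y i) w"
      using free_quandle_generated[OF universe free r] by blast
    then have "y \<in> insert i (fst ` set w) \<rightarrow> carrier F"
      using free_quandleD(2)[OF free] by blast
    note * = qop_word_act[OF _ this]
    from * w show "\<exists>w. fst ` set w \<subseteq> {1..n} \<and> (\<forall>a\<in>carrier F. (\<lambda>q\<in>carrier F. q \<triangleleft>\<^bsub>F\<^esub> r) a = word_act F y a w)"
      by (intro exI[of _ "winv w @ (i, True) # w"]) (simp add: image_Un)
    from * w show "\<exists>w. fst ` set w \<subseteq> {1..n} \<and> (\<forall>a\<in>carrier F. (\<lambda>q\<in>carrier F. q \<triangleleft>\<inverse>\<^bsub>F\<^esub> r) a = word_act F y a w)"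
      by (intro exI[of _ "winv w @ (i, False) # w"]) (simp add: image_Un)
  qed
  {
    case (incl h)
    then show ?case using single(1) by blast
  next
    case (inv h)
    then obtain r where "r \<in> carrier F" "h = (\<lambda>q\<in>carrier F. q \<triangleleft>\<^bsub>F\<^esub> r)" by blast
    then show ?case using single(2)[of r] inv_inner[of r] by simp
  next
    case (eng h k)
    then obtain v w where v: "fst ` set v \<subseteq> {1..n}" "\<forall>a\<in>carrier F. h a = word_act F y a v"
      and w: "fst ` set w \<subseteq> {1..n}" "\<forall>a\<in>carrier F. k a = word_act F y a w" by blast
    have "y \<in> fst ` set w \<rightarrow> carrier F" using w free_quandleD(2)[OF free] by blast
    then have "\<forall>a\<in>carrier F. (h \<otimes>\<^bsub>quandle_aut F\<^esub> k) a = word_act F y a (w @ v)"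
      using v w by (simp add: quandle_aut_def compose_eq word_act_append word_act_closed)
    then show ?case using v w by (intro exI[of _ "w @ v"]) (simp add: image_Un)
  }
qed

text \<open>Gives the same criterion by words as \<open>categorical_inner_iff\<close>, so the two
  notions of inner automorphism coincide.\<close>

lemma algebraic_inner_iff:
  fixes F :: "'u quandle"
  assumes universe: "infinite (UNIV :: 'u set)" and free: "free_quandle n y F"
    and h: "h \<in> quandle_hom F F"
  shows "h \<in> algebraic_inner F \<longleftrightarrow>
    (\<exists>w. w \<in> reduced_words n \<and> (\<forall>a\<in>carrier F. h a = word_act F y a w))"
proof
  interpret quandle F by (rule free_quandleD[OF free])
  have y: "y \<in> {1..n} \<rightarrow> carrier F" by (rule free_quandleD[OF free])
  {
    assume "h \<in> algebraic_inner F"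
    from free_algebraic_inner_word[OF universe free this] obtain w
      where w: "fst ` set w \<subseteq> {1..n}" "\<forall>a\<in>carrier F. h a = word_act F y a w" by blast
    then have "y \<in> fst ` set w \<rightarrow> carrier F" using y by blast
    with w(2) have "\<forall>a\<in>carrier F. h a = word_act F y a (reduce w)"
      by (simp add: word_act_reduce)
    moreover have "reduce w \<in> reduced_words n"
      using w(1) set_reduce[of w] by (auto simp: reduced_words_eq)
    ultimately show "\<exists>w. w \<in> reduced_words n \<and> (\<forall>a\<in>carrier F. h a = word_act F y a w)" by blast
  next
    assume "\<exists>w. w \<in> reduced_words n \<and> (\<forall>a\<in>carrier F. h a = word_act F y a w)"
    then obtain w where w: "w \<in> reduced_words n" "\<And>a. a \<in> carrier F \<Longrightarrow> h a = word_act F y a w"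
      by blast
    have "h = (\<lambda>a\<in>carrier F. word_act F y a w)"
      using quandle_homD(1)[OF h] w(2) by (intro extensionalityI) auto
    moreover have "y \<in> fst ` set w \<rightarrow> carrier F" using w(1) y by (auto simp: reduced_words_eq)
    ultimately show "h \<in> algebraic_inner F" using word_act_algebraic_inner by simp
  }
qed

theorem corollary3p6:
  fixes n :: nat and y :: "nat \<Rightarrow> 'u" and F :: "'u quandle"
  assumes universe: "infinite (UNIV :: 'u set)"
    and free: "free_quandle n y F"
  shows "(\<forall>\<pi> \<in> endo_families F.
            \<pi> \<in> carrier (isotropy_group F) \<longleftrightarrow>
            (\<exists>!w. w \<in> reduced_words n \<and>
              (\<forall>(Q, h) \<in> quandles_under F. \<forall>q\<in>carrier Q.
                 \<pi> (Q, h) q = word_act Q (\<lambda>i. h (y i)) q w)))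
       \<and> (\<forall>h \<in> quandle_hom F F.
            (h \<in> categorical_inner F \<longleftrightarrow>
              (\<exists>w. w \<in> reduced_words n \<and> (\<forall>a\<in>carrier F. h a = word_act F y a w))) \<and>
            (n \<noteq> 1 \<longrightarrow> (h \<in> categorical_inner F \<longleftrightarrow>
              (\<exists>!w. w \<in> reduced_words n \<and> (\<forall>a\<in>carrier F. h a = word_act F y a w)))))
       \<and> (\<forall>h \<in> quandle_hom F F. h \<in> categorical_inner F \<longleftrightarrow> h \<in> algebraic_inner F)"
proof (intro conjI ballI impI)
  note qF = free_quandleD[OF free]
  fix \<pi> assume \<pi>: "\<pi> \<in> endo_families F"
  let ?P = "\<lambda>w. w \<in> reduced_words n \<and> (\<forall>(Q, h) \<in> quandles_under F. \<forall>q\<in>carrier Q.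
    \<pi> (Q, h) q = word_act Q (\<lambda>i. h (y i)) q w)"
  have "\<pi> \<in> carrier (isotropy_group F)" if w: "?P w" for w
  proof (rule word_in_isotropy_group[OF qF(1)])
    show "y \<in> fst ` set w \<rightarrow> carrier F" using w qF(2) by (auto simp: reduced_words_eq)
    show "\<pi> \<in> extensional (quandles_under F)"
      using \<pi> by (auto simp: endo_families_def PiE_iff)
    fix Q h assume Qh: "(Q, h) \<in> quandles_under F"
    \<comment> \<open>\<open>?P\<close> determines values on the carrier only; extensionality
      upgrades this to equality of functions.\<close>
    then have "\<pi> (Q, h) \<in> extensional (carrier Q)"
      using \<pi> by (auto simp: endo_families_def PiE_iff intro: quandle_homD)
    then show "\<pi> (Q, h) = (\<lambda>q\<in>carrier Q. word_act Q (\<lambda>i. h (y i)) q w)"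
      using w Qh by (intro extensionalityI[of _ "carrier Q"]) auto
  qed
  moreover have "\<exists>w. ?P w" if "\<pi> \<in> carrier (isotropy_group F)"
    by (rule isotropy_word[OF universe free that]) blast
  moreover have "v = w" if "?P v" "?P w" for v w
    using that by (intro family_word_unique[OF universe free]) (auto dest!: bspec)
  ultimately show "\<pi> \<in> carrier (isotropy_group F) \<longleftrightarrow> (\<exists>!w. ?P w)" by blast
next
  fix h assume h: "h \<in> quandle_hom F F"
  note iff = categorical_inner_iff[OF universe free h]
  show "h \<in> categorical_inner F \<longleftrightarrow>
    (\<exists>w. w \<in> reduced_words n \<and> (\<forall>a\<in>carrier F. h a = word_act F y a w))" by (rule iff)
  show "h \<in> categorical_inner F \<longleftrightarrow> h \<in> algebraic_inner F"
    using iff algebraic_inner_iff[OF universe free h] by simp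
  assume "n \<noteq> 1"
  then have "v = w" if "v \<in> reduced_words n \<and> (\<forall>a\<in>carrier F. h a = word_act F y a v)"
    "w \<in> reduced_words n \<and> (\<forall>a\<in>carrier F. h a = word_act F y a w)" for v w
    using that by (intro word_unique[OF universe free]) auto
  with iff show "h \<in> categorical_inner F \<longleftrightarrow>
    (\<exists>!w. w \<in> reduced_words n \<and> (\<forall>a\<in>carrier F. h a = word_act F y a w))" by blast
qed

end
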